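(* Let $A\in\mathbb{R}^{n_x\times n_x}$, $B\in\mathbb{R}^{n_x\times n_u}$ with $(A,B)$ stabilizable and $\rho(A)>0$; let $Q=Q^T>0$, $R=R^T>0$; and let $\tilde\beta>0$, $\alpha_0>0$ satisfy $\tilde\beta+\alpha_0<1/\rho(A)$. Let data $x(k_l),u(k_l),x(k_l+1)$, $l=0,\ldots,s$, with $x(k_l+1)=Ax(k_l)+Bu(k_l)$, be collected such that $$\mathrm{rank}(\Gamma_X)=\tfrac12(n_x+n_u)(n_x+n_u+1).$$ Set $\tilde K^0=0$ and, for $j=0,1,\ldots$, with $\gamma_j=\tilde\beta+\sum_{m=0}^{j}\alpha_m$, update $$vecs(\tilde H^j)=(\tilde\Theta^{jT}\tilde\Theta^j)^{-1}\tilde\Theta^{jT}\xi,\qquad \tilde K^{j+1}=(\tilde H^j_{uu})^{-1}\tilde H^j_{ux},\qquad \tilde P^j=\begin{bmatrix}I_{n_x}\\ -\tilde K^j\end{bmatrix}^T\tilde H^j\begin{bmatrix}I_{n_x}\\ -\tilde K^j\end{bmatrix},$$ and choose $\alpha_{j+1}$ with $$0<\alpha_{j+1}<\gamma_j\sqrt{\frac{\sigma_{\min}[Q+(\tilde K^{j+1})^TR\tilde K^{j+1}]}{\sigma_{\max}[\tilde P^j-Q-(\tilde K^{j+1})^TR\tilde K^{j+1}]}+1}-\gamma_j,$$ until $\gamma_{j+1}=\tilde\beta+\sum_{m=0}^{j+1}\alpha_m\ge1$. Then the closed-loop system satisfies $\rho(A-B\tilde K^{j+1})<1/\big(\tilde\beta+\sum_{m=0}^{j+1}\alpha_m\big)$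 for $j=0,1,2,\ldots$, and the gain $\tilde K^{j+1}$ obtained when $\gamma_{j+1}\ge1$ is a stabilizing control gain of $x(k+1)=Ax(k)+Bu(k)$, i.e. $\rho(A-B\tilde K^{j+1})<1$. Moreover, setting $K^0=\tilde K^{j+1}$ for this final $j$ and updating, for $i=0,1,2,\ldots$, $$vecs(H^i)=(\Theta^{iT}\Theta^i)^{-1}\Theta^{iT}\xi,\qquad K^{i+1}=(H^i_{uu})^{-1}H^i_{ux},$$ one has $\lim_{i\to\infty}H^i=H^*$; and, with $P^i=\begin{bmatrix}I_{n_x}\\ -K^i\end{bmatrix}^TH^i\begin{bmatrix}I_{n_x}\\ -K^i\end{bmatrix}$, the algebraic Riccati equation is solved in the limit by $P^i$ and $K^{i+1}$, i.e. $\lim_{i\to\infty}P^i=P^*$ and $\lim_{i\to\infty}K^{i+1}=K^*$.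
   Context: $\rho(\cdot)$ is the spectral radius, $\sigma_{\max},\sigma_{\min}$ the maximum and minimum singular values, and $>0$ for symmetric matrices means positive definite. For symmetric $X\in\mathbb{R}^{n\times n}$, $vecs(X)=[X_{1,1},2X_{1,2},\ldots,2X_{1,n},X_{2,2},2X_{2,3},\ldots,2X_{n-1,n},X_{n,n}]^T$. For $\chi\in\mathbb{R}^n$, $vecv(\chi)=[\chi_1^2,\chi_1\chi_2,\ldots,\chi_1\chi_n,\chi_2^2,\chi_2\chi_3,\ldots,\chi_{n-1}\chi_n,\chi_n^2]^T$, so that $vecv(\chi)^Tvecs(X)=\chi^TX\chi$. A symmetric $H\in\mathbb{R}^{(n_x+n_u)\times(n_x+n_u)}$ is partitioned as $H=\begin{bmatrix}H_{xx}&H_{xu}\\ H_{ux}&H_{uu}\end{bmatrix}$ with $H_{xx}\in\mathbb{R}^{n_x\times n_x}$, $H_{uu}\in\mathbb{R}^{n_u\times n_u}$ (same for $\tilde H^j$, $H^i$, which are symmetric). $P^*=(P^* )^T>0$ is the positive definite solution of the algebraic Riccati equation $A^TPA-P-A^TPB(R+B^TPB)^{-1}B^TPA=-Q$, $K^*=(R+B^TP^*B)^{-1}B^TP^*A$, and $H^*$ is the matrix of the optimal $\mathcal{Q}$-function $x^TQx+u^TRu+(Ax+Bu)^TP^*(Ax+Bu)$, i.e. $H^*=\begin{bmatrix}A^TP^*A+Q & A^TP^*B \\ B^TP^*A & B^TP^*B+R\end{bmatrix}$. Data matrices (with $k_0<k_1<\cdots<k_s$): $X(k)=[x(k)^T,u(k)^T]^T$;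 $\Gamma_X$ has rows $vecv(X(k_l))^T$, $l=0,\ldots,s$; for a gain $K\in\mathbb{R}^{n_u\times n_x}$, $\Gamma_x(K)$ has rows $vecv(z_l)^T$ with $z_l=[x(k_l+1)^T,(-Kx(k_l+1))^T]^T$. Further, $\bar Q=\begin{bmatrix}Q&0\\ 0&R\end{bmatrix}$, $\xi=\Gamma_Xvecs(\bar Q)$, $\tilde\Theta^j=\Gamma_X-\gamma_j^2\Gamma_x(\tilde K^j)$, and $\Theta^i=\Gamma_X-\Gamma_x(K^i)$. *)

theory Defs
  imports
    Complex_Main
    "Jordan_Normal_Form.Spectral_Radius"
    "Jordan_Normal_Form.DL_Rank"
    "Jordan_Normal_Form.Gauss_Jordan_Elimination"
begin

definition rho :: "real mat \<Rightarrow> real" where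
  "rho M = spectral_radius (map_mat complex_of_real M)"

(* The singular values of a square matrix M are the square roots of the eigenvalues of M^T M.
   (For a matrix with more columns than rows, this set would contain an extra 0.) *)
definition singular_values :: "real mat \<Rightarrow> real set" where
  "singular_values M = sqrt ` {e. eigenvalue (M\<^sup>T * M) e}"

definition sigma_max :: "real mat \<Rightarrow> real" where
  "sigma_max M = Max (singular_values M)"

definition sigma_min :: "real mat \<Rightarrow> real" where
  "sigma_min M = Min (singular_values M)"

definition sym_mat :: "nat \<Rightarrow> real mat \<Rightarrow> bool" where
  "sym_mat n M \<longleftrightarrow> M \<in> carrier_mat n n \<and> M\<^sup>T = M"

definition sym_pos_def :: "nat \<Rightarrow> real mat \<Rightarrow> bool" where
  "sym_pos_def n M \<longleftrightarrow> sym_mat n M \<and> (\<forall>v \<in> carrier_vec n. v \<noteq> 0\<^sub>v n \<longrightarrow> 0 < v \<bullet> (M *\<^sub>v v))"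

definition stabilizable :: "nat \<Rightarrow> nat \<Rightarrow> real mat \<Rightarrow> real mat \<Rightarrow> bool" where
  "stabilizable nx nu A B \<longleftrightarrow> (\<exists>K \<in> carrier_mat nu nx. rho (A - B * K) < 1)"

(* Unspecified if M is singular. *)
definition minv :: "real mat \<Rightarrow> real mat" where
  "minv M = the (mat_inverse M)"

(* The index pairs (i,j) with i \<le> j < n, in row-major order. *)
definition upper_pairs :: "nat \<Rightarrow> (nat \<times> nat) list" where
  "upper_pairs n = concat (map (\<lambda>i. map (\<lambda>j. (i, j)) [i..<n]) [0..<n])"

definition vecs :: "real mat \<Rightarrow> real vec" where
  "vecs M = vec_of_list
     (map (\<lambda>(i, j). if i = j then M $$ (i, j) else 2 * M $$ (i, j)) (upper_pairs (dim_row M)))"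

definition vecv :: "real vec \<Rightarrow> real vec" where
  "vecv v = vec_of_list (map (\<lambda>(i, j). v $ i * v $ j) (upper_pairs (dim_vec v)))"

definition block_ux :: "nat \<Rightarrow> real mat \<Rightarrow> real mat" where
  "block_ux nx H = (case split_block H nx nx of (Hxx, Hxu, Hux, Huu) \<Rightarrow> Hux)"

definition block_uu :: "nat \<Rightarrow> real mat \<Rightarrow> real mat" where
  "block_uu nx H = (case split_block H nx nx of (Hxx, Hxu, Hux, Huu) \<Rightarrow> Huu)"

definition Gamma_X ::
  "nat \<Rightarrow> nat \<Rightarrow> (nat \<Rightarrow> real vec) \<Rightarrow> (nat \<Rightarrow> real vec) \<Rightarrow> (nat \<Rightarrow> nat) \<Rightarrow> nat \<Rightarrow> real mat" where
  "Gamma_X nx nu x u k s =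
     mat_of_rows ((nx + nu) * (nx + nu + 1) div 2)
       (map (\<lambda>l. vecv (x (k l) @\<^sub>v u (k l))) [0..<s + 1])"

definition Gamma_x ::
  "nat \<Rightarrow> nat \<Rightarrow> (nat \<Rightarrow> real vec) \<Rightarrow> (nat \<Rightarrow> nat) \<Rightarrow> nat \<Rightarrow> real mat \<Rightarrow> real mat" where
  "Gamma_x nx nu x k s K =
     mat_of_rows ((nx + nu) * (nx + nu + 1) div 2)
       (map (\<lambda>l. vecv (x (k l + 1) @\<^sub>v (- (K *\<^sub>v x (k l + 1))))) [0..<s + 1])"

definition Qbar :: "nat \<Rightarrow> nat \<Rightarrow> real mat \<Rightarrow> real mat \<Rightarrow> real mat" where
  "Qbar nx nu Q R = four_block_mat Q (0\<^sub>m nx nu) (0\<^sub>m nu nx) R"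

definition least_squares :: "real mat \<Rightarrow> real vec \<Rightarrow> real vec" where
  "least_squares \<Theta> \<xi> = (minv (\<Theta>\<^sup>T * \<Theta>) * \<Theta>\<^sup>T) *\<^sub>v \<xi>"

definition gain_of :: "nat \<Rightarrow> real mat \<Rightarrow> real mat" where
  "gain_of nx H = minv (block_uu nx H) * block_ux nx H"

definition value_of :: "nat \<Rightarrow> real mat \<Rightarrow> real mat \<Rightarrow> real mat" where
  "value_of nx K H = (1\<^sub>m nx @\<^sub>r (- K))\<^sup>T * H * (1\<^sub>m nx @\<^sub>r (- K))"

definition ARE :: "real mat \<Rightarrow> real mat \<Rightarrow> real mat \<Rightarrow> real mat \<Rightarrow> real mat \<Rightarrow> bool" where
  "ARE A B Q R P \<longleftrightarrow>
     A\<^sup>T * P * A - P - A\<^sup>T * P * B * minv (R + B\<^sup>T * P * B) * B\<^sup>T * P * A = - Q"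

definition optimal_gain :: "real mat \<Rightarrow> real mat \<Rightarrow> real mat \<Rightarrow> real mat \<Rightarrow> real mat" where
  "optimal_gain A B R P = minv (R + B\<^sup>T * P * B) * B\<^sup>T * P * A"

definition Q_function_mat :: "real mat \<Rightarrow> real mat \<Rightarrow> real mat \<Rightarrow> real mat \<Rightarrow> real mat \<Rightarrow> real mat" where
  "Q_function_mat A B Q R P =
     four_block_mat (A\<^sup>T * P * A + Q) (A\<^sup>T * P * B) (B\<^sup>T * P * A) (B\<^sup>T * P * B + R)"

(* Type "real mat" carries no topology; for matrices of a fixed size, entrywise convergence is
   convergence in any norm. *)
definition mat_tendsto :: "(nat \<Rightarrow> real mat) \<Rightarrow> real mat \<Rightarrow> bool" where
  "mat_tendsto F L \<longleftrightarrow>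
     (\<forall>i. F i \<in> carrier_mat (dim_row L) (dim_col L)) \<and>
     (\<forall>r < dim_row L. \<forall>c < dim_col L. (\<lambda>i. F i $$ (r, c)) \<longlonglongrightarrow> L $$ (r, c))"

(* Iteration j of the first loop is executed iff its stopping test "g m \<ge> 1", evaluated at the end
   of iteration m - 1, has failed for m = 1, ..., j. The test is not applied to g 0. *)
definition executed :: "(nat \<Rightarrow> real) \<Rightarrow> nat \<Rightarrow> bool" where
  "executed g j \<longleftrightarrow> (\<forall>m. 1 \<le> m \<and> m \<le> j \<longrightarrow> g m < 1)"

end

theory Submission
  imports Defs
begin

text \<open>
  Since \<open>x(k+1) = A x(k) + B u(k)\<close>, every row of the regression for a gain \<open>K\<close> and a factor \<open>g\<close> evaluates
  a quadratic form, and the full rank of the data turns the regression into the Lyapunov equation for the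
  Q-function of \<open>K\<close> on the scaled system \<open>(g A, g B)\<close>; it is uniquely solvable when
  \<open>g \<rho>(A - B K) < 1\<close>. So both loops are policy iteration. If \<open>K'\<close> is greedy for the value matrix \<open>P\<close>, then
  \<open>g\<^sup>2 (A - B K')\<^sup>T P (A - B K') \<le> P - Q - K'\<^sup>T R K'\<close>, and the bound on \<open>\<alpha>\<close> is the slack by which
  \<open>g\<close> may grow while this stays a strict Lyapunov inequality. In the second loop the error \<open>P\<^sup>i - P\<^sup>*\<close>
  is nonnegative and contracted by the stable optimal closed loop \<open>A - B K\<^sup>*\<close>, so it vanishes in the limit;
  no monotone limit of matrices and no uniqueness theorem for the Riccati equation is needed.
\<close>

section \<open>Quadratic forms\<close>

text \<open>Order and limits of symmetric matrices are expressed through \<open>qform\<close> at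
  each single vector, so every comparison of value matrices becomes a scalar inequality along an
  orbit of a stable closed loop. The solution of the Lyapunov equation is not built as a convergent
  series: stability gives uniqueness, and for a linear map on symmetric matrices, written in
  half-vectorized coordinates, uniqueness gives existence. Exact data then put \<open>\<xi>\<close>
  into the range of the regression matrix, so the least squares formula solves the regression
  without residual. The iteration only ever yields nonnegative value matrices. Invertibility of B^T
  P B + R therefore rests on R, and the strictness in the stability argument of the second loop on
  Q. The first loop carries the invariant g rho(A - B K) < 1. It holds initially because K = 0 and
  \<open>\<beta> + \<alpha> 0 < 1 / rho A\<close>, and each new gain satisfies it already for the
  enlarged factor. Stability of the optimal closed loop is read off from the Riccati equation, which
  turns into a Lyapunov equation once \<open>optimal_gain\<close> is recognised as the greedy gain
  of the Riccati solution.\<close>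

definition qform :: "real mat \<Rightarrow> real vec \<Rightarrow> real" where
  "qform M v = v \<bullet> (M *\<^sub>v v)"

lemma sym_mat_carrier: "sym_mat n M \<Longrightarrow> M \<in> carrier_mat n n"
  by (simp add: sym_mat_def)

lemma sym_mat_swap:
  assumes "sym_mat n M" "u \<in> carrier_vec n" "v \<in> carrier_vec n"
  shows "u \<bullet> (M *\<^sub>v v) = v \<bullet> (M *\<^sub>v u)"
proof -
  have M: "M \<in> carrier_mat n n" "M\<^sup>T = M" using assms by (auto simp: sym_mat_def)
  have "u \<bullet> (M *\<^sub>v v) = (M\<^sup>T *\<^sub>v u) \<bullet> v"
    using transpose_vec_mult_scalar[OF M(1) assms(3,2)] by simp
  also have "\<dots> = v \<bullet> (M *\<^sub>v u)"
    using M assms by (metis comm_scalar_prod mult_mat_vec_carrier)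
  finally show ?thesis .
qed

lemma smult_mat_mult_vec:
  fixes M :: "real mat"
  assumes "M \<in> carrier_mat m n" "v \<in> carrier_vec n"
  shows "(c \<cdot>\<^sub>m M) *\<^sub>v v = c \<cdot>\<^sub>v (M *\<^sub>v v)"
  using assms by (intro eq_vecI) (auto simp: scalar_prod_def sum_distrib_left algebra_simps)

lemma mat_mult_zero_vec:
  fixes M :: "real mat"
  shows "M \<in> carrier_mat m n \<Longrightarrow> M *\<^sub>v 0\<^sub>v n = 0\<^sub>v m"
  by (intro eq_vecI) auto

lemma zero_mat_mult_vec:
  fixes v :: "real vec"
  shows "v \<in> carrier_vec n \<Longrightarrow> 0\<^sub>m m n *\<^sub>v v = 0\<^sub>v m"
  by (intro eq_vecI) auto

lemma qform_zero_mat: "v \<in> carrier_vec n \<Longrightarrow> qform (0\<^sub>m n n) v = 0"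
  by (simp add: qform_def zero_mat_mult_vec)

lemma qform_zero: "M \<in> carrier_mat n n \<Longrightarrow> qform M (0\<^sub>v n) = 0"
  by (simp add: qform_def mat_mult_zero_vec)

lemma qform_add:
  assumes "sym_mat n M" "u \<in> carrier_vec n" "v \<in> carrier_vec n"
  shows "qform M (u + v) = qform M u + 2 * (u \<bullet> (M *\<^sub>v v)) + qform M v"
proof -
  have M: "M \<in> carrier_mat n n" using assms by (simp add: sym_mat_def)
  have c: "M *\<^sub>v u \<in> carrier_vec n" "M *\<^sub>v v \<in> carrier_vec n" using M assms by auto
  show ?thesis
    unfolding qform_def using assms M c sym_mat_swap[OF assms]
    by (simp add: mult_add_distrib_mat_vec[OF M] scalar_prod_add_distrib[of _ n] add_scalar_prod_distrib[of _ n])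
qed

lemma qform_smult:
  assumes "M \<in> carrier_mat n n" "v \<in> carrier_vec n"
  shows "qform M (c \<cdot>\<^sub>v v) = c\<^sup>2 * qform M v"
  unfolding qform_def using assms
  by (simp add: mult_mat_vec power2_eq_square)

lemma qform_minus:
  assumes "sym_mat n M" "u \<in> carrier_vec n" "v \<in> carrier_vec n"
  shows "qform M (u - v) = qform M u - 2 * (u \<bullet> (M *\<^sub>v v)) + qform M v"
proof -
  have M: "M \<in> carrier_mat n n" using assms by (simp add: sym_mat_def)
  have e: "u - v = u + (-1) \<cdot>\<^sub>v v" using assms by auto
  show ?thesis unfolding e
    using qform_add[OF assms(1,2), of "(-1) \<cdot>\<^sub>v v"] qform_smult[OF M assms(3), of "-1"] M assms
    by (simp add: mult_mat_vec[OF M assms(3)])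
qed

lemma qform_mat_add:
  assumes "M \<in> carrier_mat n n" "N \<in> carrier_mat n n" "v \<in> carrier_vec n"
  shows "qform (M + N) v = qform M v + qform N v"
  unfolding qform_def using assms
  by (simp add: add_mult_distrib_mat_vec[of _ n n] scalar_prod_add_distrib[of _ n])

lemma qform_mat_minus:
  assumes "M \<in> carrier_mat n n" "N \<in> carrier_mat n n" "v \<in> carrier_vec n"
  shows "qform (M - N) v = qform M v - qform N v"
  unfolding qform_def using assms
  by (simp add: minus_mult_distrib_mat_vec[of _ n n] scalar_prod_minus_distrib[of _ n])

lemma qform_mat_smult:
  assumes "M \<in> carrier_mat n n" "v \<in> carrier_vec n"
  shows "qform (c \<cdot>\<^sub>m M) v = c * qform M v"
  unfolding qform_def using assms
  by (simp add: smult_mat_mult_vec[of _ n n])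

lemma qform_one: "v \<in> carrier_vec n \<Longrightarrow> qform (1\<^sub>m n) v = v \<bullet> v"
  by (simp add: qform_def)

lemma bilinear_congruence:
  fixes P :: "real mat"
  assumes X: "X \<in> carrier_mat m n" and P: "P \<in> carrier_mat m m" and Y: "Y \<in> carrier_mat m k"
    and v: "v \<in> carrier_vec n" and w: "w \<in> carrier_vec k"
  shows "v \<bullet> ((X\<^sup>T * P * Y) *\<^sub>v w) = (X *\<^sub>v v) \<bullet> (P *\<^sub>v (Y *\<^sub>v w))"
proof -
  have Xt: "X\<^sup>T \<in> carrier_mat n m" using X by simp
  have z: "P *\<^sub>v (Y *\<^sub>v w) \<in> carrier_vec m" using P Y w by simp
  have "(X\<^sup>T * P * Y) *\<^sub>v w = X\<^sup>T *\<^sub>v (P *\<^sub>v (Y *\<^sub>v w))"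
    using Xt P Y w by (simp add: assoc_mult_mat_vec[of _ n m _ k] assoc_mult_mat_vec[of _ n m _ m])
  moreover have "v \<bullet> (X\<^sup>T *\<^sub>v (P *\<^sub>v (Y *\<^sub>v w))) = (X *\<^sub>v v) \<bullet> (P *\<^sub>v (Y *\<^sub>v w))"
    using transpose_vec_mult_scalar[OF Xt z v] by simp
  ultimately show ?thesis by simp
qed

lemma qform_congruence:
  assumes "A \<in> carrier_mat m n" "M \<in> carrier_mat m m" "v \<in> carrier_vec n"
  shows "qform (A\<^sup>T * M * A) v = qform M (A *\<^sub>v v)"
  unfolding qform_def by (rule bilinear_congruence[OF assms(1,2,1,3,3)])

lemma sym_mat_add: "sym_mat n M \<Longrightarrow> sym_mat n N \<Longrightarrow> sym_mat n (M + N)"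
  unfolding sym_mat_def using transpose_add[of M n n N] by auto

lemma sym_mat_minus: "sym_mat n M \<Longrightarrow> sym_mat n N \<Longrightarrow> sym_mat n (M - N)"
  unfolding sym_mat_def using transpose_minus[of M n n N] by auto

lemma sym_mat_smult: "sym_mat n M \<Longrightarrow> sym_mat n (c \<cdot>\<^sub>m M)"
  by (auto simp: sym_mat_def intro!: eq_matI) (metis carrier_matD index_transpose_mat(1))

lemma sym_mat_congruence:
  assumes "A \<in> carrier_mat m n" "sym_mat m M"
  shows "sym_mat n (A\<^sup>T * M * A)"
proof -
  have M: "M \<in> carrier_mat m m" "M\<^sup>T = M" using assms by (auto simp: sym_mat_def)
  have "(A\<^sup>T * M * A)\<^sup>T = A\<^sup>T * (A\<^sup>T * M)\<^sup>T" using assms M by (intro transpose_mult) auto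
  also have "\<dots> = A\<^sup>T * (M * A)" using assms M by (simp add: transpose_mult[of _ n m])
  also have "\<dots> = A\<^sup>T * M * A" using assms M by (simp add: assoc_mult_mat[of _ n m _ m])
  finally show ?thesis using assms M by (simp add: sym_mat_def)
qed

lemma unit_vec_bilinear:
  assumes "M \<in> carrier_mat n n" "i < n" "j < n"
  shows "unit_vec n i \<bullet> (M *\<^sub>v unit_vec n j) = (M $$ (i, j) :: real)"
  using assms by (simp add: scalar_prod_left_unit[of _ n])

text \<open>Allows equality and limits of symmetric matrices to be checked on quadratic forms alone,
  as in \<open>sym_mat_eqI\<close> and \<open>sym_mat_tendsto\<close>.\<close>

lemma polarization:
  assumes "sym_mat n M" "i < n" "j < n"
  shows "M $$ (i, j) =
    (qform M (unit_vec n i + unit_vec n j) - qform M (unit_vec n i) - qform M (unit_vec n j)) / 2"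
  using qform_add[OF assms(1), of "unit_vec n i" "unit_vec n j"]
    unit_vec_bilinear[OF sym_mat_carrier[OF assms(1)] assms(2,3)] assms by simp

lemma sym_mat_eqI:
  assumes "sym_mat n M" "sym_mat n N" "\<And>v. v \<in> carrier_vec n \<Longrightarrow> qform M v = qform N v"
  shows "M = N"
proof (rule eq_matI)
  fix i j assume "i < dim_row N" "j < dim_col N"
  then have ij: "i < n" "j < n" using assms(2) by (auto simp: sym_mat_def)
  show "M $$ (i, j) = N $$ (i, j)"
    unfolding polarization[OF assms(1) ij] polarization[OF assms(2) ij] using assms(3) by simp
qed (use assms in \<open>auto simp: sym_mat_def\<close>)

lemma sym_mat_append_eqI:
  assumes "sym_mat (n + m) M" "sym_mat (n + m) N"
    "\<And>v w. v \<in> carrier_vec n \<Longrightarrow> w \<in> carrier_vec m \<Longrightarrow> qform M (v @\<^sub>v w) = qform N (v @\<^sub>v w)"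
  shows "M = N"
  by (rule sym_mat_eqI[OF assms(1,2)]) (metis assms(3) vec_first_carrier vec_last_carrier vec_first_last_append)

lemma sym_mat_tendsto:
  assumes F: "\<And>i. sym_mat n (F i)" and L: "sym_mat n L"
    and lim: "\<And>v. v \<in> carrier_vec n \<Longrightarrow> (\<lambda>i. qform (F i) v) \<longlonglongrightarrow> qform L v"
  shows "mat_tendsto F L"
  unfolding mat_tendsto_def
proof (intro conjI allI impI)
  fix i show "F i \<in> carrier_mat (dim_row L) (dim_col L)" using F[of i] L by (auto simp: sym_mat_def)
next
  fix r c assume "r < dim_row L" "c < dim_col L"
  then have rc: "r < n" "c < n" using L by (auto simp: sym_mat_def)
  show "(\<lambda>i. F i $$ (r, c)) \<longlonglongrightarrow> L $$ (r, c)"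
    unfolding polarization[OF F rc] polarization[OF L rc] by (intro tendsto_intros lim) auto
qed

lemma scalar_prod_self_pos:
  assumes "v \<in> carrier_vec n" "v \<noteq> 0\<^sub>v n"
  shows "0 < v \<bullet> (v :: real vec)"
proof -
  obtain i where i: "i < n" "v $ i \<noteq> 0" using assms by (metis carrier_vecD eq_vecI index_zero_vec)
  have "0 < (\<Sum>i\<in>{0..<n}. v $ i * v $ i)"
    by (rule sum_pos2[of _ i]) (use i in \<open>auto simp: zero_less_mult_iff\<close>)
  then show ?thesis using assms by (simp add: scalar_prod_def)
qed

lemma scalar_prod_self_nonneg: "0 \<le> v \<bullet> (v :: real vec)"
  by (auto simp: scalar_prod_def intro: sum_nonneg)

lemma scalar_prod_self_zero:
  "v \<in> carrier_vec n \<Longrightarrow> v \<bullet> (v :: real vec) = 0 \<Longrightarrow> v = 0\<^sub>v n"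
  using scalar_prod_self_pos[of v n] by fastforce

lemma vec_index_le_norm:
  assumes "i < dim_vec v"
  shows "(v $ i)\<^sup>2 \<le> v \<bullet> (v :: real vec)"
  unfolding scalar_prod_def power2_eq_square
  by (rule member_le_sum[where f = "\<lambda>i. v $ i * v $ i"]) (use assms in auto)

section \<open>Upper and lower bounds of quadratic forms\<close>

lemma qform_bound:
  assumes M: "M \<in> carrier_mat n n"
  obtains C where "C > 0" "\<And>v. v \<in> carrier_vec n \<Longrightarrow> \<bar>qform M v\<bar> \<le> C * (v \<bullet> v)"
proof
  \<comment> \<open>The entry sum bounds the form because each product of two coordinates is at most
    \<open>v \<bullet> v\<close> in absolute value. The 1 added below keeps the constant positive
    for the zero matrix, since callers divide by it.\<close>
  let ?S = "\<Sum>i<n. \<Sum>j<n. \<bar>M $$ (i, j)\<bar>"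
  have "0 \<le> ?S" by (intro sum_nonneg) auto
  then show "1 + ?S > 0" by linarith
  fix v :: "real vec" assume v: "v \<in> carrier_vec n"
  have "qform M v = (\<Sum>i<n. \<Sum>j<n. M $$ (i, j) * (v $ i * v $ j))"
    using M v by (simp add: qform_def scalar_prod_def sum_distrib_left atLeast0LessThan algebra_simps)
  also have "\<bar>\<dots>\<bar> \<le> (\<Sum>i<n. \<Sum>j<n. \<bar>M $$ (i, j)\<bar> * (v \<bullet> v))"
  proof (rule order_trans[OF sum_abs], rule sum_mono, rule order_trans[OF sum_abs], rule sum_mono)
    fix i j assume ij: "i \<in> {..<n}" "j \<in> {..<n}"
    have "\<bar>v $ i * v $ j\<bar> \<le> ((v $ i)\<^sup>2 + (v $ j)\<^sup>2) / 2"
      using sum_squares_bound[of "\<bar>v $ i\<bar>" "\<bar>v $ j\<bar>"] by (simp add: abs_mult)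
    also have "\<dots> \<le> v \<bullet> v" using vec_index_le_norm[of i v] vec_index_le_norm[of j v] ij v by simp
    finally show "\<bar>M $$ (i, j) * (v $ i * v $ j)\<bar> \<le> \<bar>M $$ (i, j)\<bar> * (v \<bullet> v)"
      by (simp add: abs_mult mult_left_mono)
  qed
  also have "\<dots> = ?S * (v \<bullet> v)" by (simp add: sum_distrib_right)
  also have "\<dots> \<le> (1 + ?S) * (v \<bullet> v)" using scalar_prod_self_nonneg[of v] by (simp add: algebra_simps)
  finally show "\<bar>qform M v\<bar> \<le> (1 + ?S) * (v \<bullet> v)" .
qed

text \<open>The only access to \<open>minv\<close>, which is unspecified on singular matrices: a
  trivial kernel gives a nonzero determinant, hence a unit, hence a result \<open>Some\<close> of
  \<open>mat_inverse\<close>.\<close>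

lemma minv_inverse:
  assumes T: "T \<in> carrier_mat n n"
    and inj: "\<And>v. v \<in> carrier_vec n \<Longrightarrow> T *\<^sub>v v = 0\<^sub>v n \<Longrightarrow> v = 0\<^sub>v n"
  shows "minv T \<in> carrier_mat n n" "minv T * T = 1\<^sub>m n" "T * minv T = 1\<^sub>m n"
proof -
  have "det T \<noteq> 0" using det_0_iff_vec_prod_zero_field[OF T] inj by blast
  then have "T \<in> Units (ring_mat TYPE(real) n ())" using det_non_zero_imp_unit[OF T] by auto
  then obtain S where S: "mat_inverse T = Some S" using mat_inverse(1)[OF T, where b = "()"] by (cases "mat_inverse T") auto
  show "minv T \<in> carrier_mat n n" "minv T * T = 1\<^sub>m n" "T * minv T = 1\<^sub>m n"
    using mat_inverse(2)[OF T S] S by (auto simp: minv_def)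
qed

(* With w = T v, the form is nonnegative at v - w / C, which bounds |w|^2 by C times the form at v. *)
lemma psd_injective_coercive:
  assumes sym: "sym_mat n T"
    and psd: "\<And>v. v \<in> carrier_vec n \<Longrightarrow> 0 \<le> qform T v"
    and inj: "\<And>v. v \<in> carrier_vec n \<Longrightarrow> T *\<^sub>v v = 0\<^sub>v n \<Longrightarrow> v = 0\<^sub>v n"
  obtains c where "c > 0" "\<And>v. v \<in> carrier_vec n \<Longrightarrow> c * (v \<bullet> v) \<le> qform T v"
proof -
  have T: "T \<in> carrier_mat n n" using sym by (simp add: sym_mat_def)
  note S = minv_inverse[OF T inj]
  obtain C where C: "C > 0" "\<And>v. v \<in> carrier_vec n \<Longrightarrow> \<bar>qform T v\<bar> \<le> C * (v \<bullet> v)"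
    using qform_bound[OF T] by blast
  \<comment> \<open>Gram matrix of the inverse: its form at w = T v is \<open>v \<bullet> v\<close>,
    so its bound D compares \<open>v \<bullet> v\<close> with \<open>w \<bullet> w\<close>.\<close>
  have "(minv T)\<^sup>T * 1\<^sub>m n * minv T \<in> carrier_mat n n" using S by simp
  then obtain D where D: "D > 0"
    "\<And>v. v \<in> carrier_vec n \<Longrightarrow> \<bar>qform ((minv T)\<^sup>T * 1\<^sub>m n * minv T) v\<bar> \<le> D * (v \<bullet> v)"
    using qform_bound by blast
  have "1 / (D * C) * (v \<bullet> v) \<le> qform T v" if v: "v \<in> carrier_vec n" for v
  proof -
    define w where "w = T *\<^sub>v v"
    have w: "w \<in> carrier_vec n" using T v by (simp add: w_def)
    have vw: "minv T *\<^sub>v w = v"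
      unfolding w_def using assoc_mult_mat_vec[OF S(1) T v] S(2) v by (metis one_mult_mat_vec)
    have "v \<bullet> v = qform ((minv T)\<^sup>T * 1\<^sub>m n * minv T) w"
      using qform_congruence[OF S(1) _ w, of "1\<^sub>m n"] v by (simp add: vw qform_one)
    then have a: "v \<bullet> v \<le> D * (w \<bullet> w)" using D(2)[OF w] by linarith
    have "0 \<le> qform T (v - (1 / C) \<cdot>\<^sub>v w)" by (rule psd) (use v w in simp)
    also have "\<dots> = qform T v - 2 / C * (w \<bullet> w) + (1 / C)\<^sup>2 * qform T w"
      using qform_minus[OF sym v, of "(1 / C) \<cdot>\<^sub>v w"] qform_smult[OF T w] w v T
        sym_mat_swap[OF sym v w] by (simp add: mult_mat_vec[OF T w] w_def[symmetric])
    also have "(1 / C)\<^sup>2 * qform T w \<le> (1 / C)\<^sup>2 * (C * (w \<bullet> w))"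
      by (rule mult_left_mono) (use C(2)[OF w] in auto)
    finally have "(w \<bullet> w) / C \<le> qform T v" using C(1) by (simp add: power2_eq_square field_simps)
    moreover have "(v \<bullet> v) / (D * C) \<le> (w \<bullet> w) / C" using a C(1) D(1) by (simp add: field_simps)
    ultimately show ?thesis by simp
  qed
  then show thesis using that[of "1 / (D * C)"] C(1) D(1) by simp
qed

lemma pos_def_pos: "sym_pos_def n M \<Longrightarrow> v \<in> carrier_vec n \<Longrightarrow> v \<noteq> 0\<^sub>v n \<Longrightarrow> 0 < qform M v"
  by (simp add: sym_pos_def_def qform_def)

lemma pos_def_injective:
  assumes "sym_pos_def n M" "v \<in> carrier_vec n" "M *\<^sub>v v = 0\<^sub>v n"
  shows "v = 0\<^sub>v n"
  using assms by (force simp: sym_pos_def_def)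

lemma pos_def_nonneg:
  assumes "sym_pos_def n M" "v \<in> carrier_vec n"
  shows "0 \<le> qform M v"
  using assms by (cases "v = 0\<^sub>v n") (force simp: sym_pos_def_def sym_mat_def qform_def)+

lemma pos_def_coercive:
  assumes "sym_pos_def n M"
  obtains c where "c > 0" "\<And>v. v \<in> carrier_vec n \<Longrightarrow> c * (v \<bullet> v) \<le> qform M v"
  using psd_injective_coercive[of n M] pos_def_nonneg[OF assms] pos_def_injective[OF assms] assms
  by (metis sym_pos_def_def)

section \<open>Extreme eigenvalues and singular values\<close>

text \<open>Take \<mu> as the supremum of the form on the unit sphere. If \<mu> I - S had trivial
  kernel, \<open>psd_injective_coercive\<close> would leave a margin c > 0, and \<mu> - c would
  still be an upper bound. So \<mu> is an eigenvalue, without an appeal to compactness or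
  diagonalization.\<close>

lemma rayleigh_max:
  assumes sym: "sym_mat n S" and n: "0 < n"
  obtains \<mu> where "eigenvalue S \<mu>" "\<And>v. v \<in> carrier_vec n \<Longrightarrow> qform S v \<le> \<mu> * (v \<bullet> v)"
proof -
  have S: "S \<in> carrier_mat n n" using sym by (simp add: sym_mat_def)
  define U where "U = {qform S v | v. v \<in> carrier_vec n \<and> v \<bullet> v = 1}"
  define \<mu> where "\<mu> = Sup U"
  obtain C where C: "C > 0" "\<And>v. v \<in> carrier_vec n \<Longrightarrow> \<bar>qform S v\<bar> \<le> C * (v \<bullet> v)"
    using qform_bound[OF S] by blast
  have bdd: "bdd_above U" unfolding U_def by (rule bdd_aboveI[of _ C]) (use C(2) in force)
  have "qform S (unit_vec n 0) \<in> U" unfolding U_def using n by (auto intro!: exI[of _ "unit_vec n 0"])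
  then have ne: "U \<noteq> {}" by blast
  have le: "qform S v \<le> (\<mu> - c) * (v \<bullet> v)" if v: "v \<in> carrier_vec n"
    and c: "\<And>t. t \<in> U \<Longrightarrow> t \<le> \<mu> - c" for v c
  proof (cases "v = 0\<^sub>v n")
    case False
    define r where "r = sqrt (v \<bullet> v)"
    have r: "r > 0" "r\<^sup>2 = v \<bullet> v" unfolding r_def using scalar_prod_self_pos[OF v False] by auto
    have "((1 / r) \<cdot>\<^sub>v v) \<bullet> ((1 / r) \<cdot>\<^sub>v v) = 1" using v r by (simp flip: r(2) add: power2_eq_square)
    then have "qform S ((1 / r) \<cdot>\<^sub>v v) \<in> U" unfolding U_def using v by force
    from c[OF this] have "(1 / r)\<^sup>2 * qform S v \<le> \<mu> - c" by (simp add: qform_smult[OF S v])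
    then have "qform S v \<le> (\<mu> - c) * r\<^sup>2" using r(1) by (simp add: power_divide pos_divide_le_eq)
    then show ?thesis by (simp only: r(2))
  qed (use S in \<open>simp add: qform_def\<close>)
  have le0: "qform S v \<le> \<mu> * (v \<bullet> v)" if "v \<in> carrier_vec n" for v
    using le[OF that, of 0] cSup_upper[OF _ bdd] by (simp add: \<mu>_def)
  define T where "T = \<mu> \<cdot>\<^sub>m 1\<^sub>m n - S"
  have symT: "sym_mat n T" unfolding T_def
    by (intro sym_mat_minus sym_mat_smult sym) (simp add: sym_mat_def)
  have qT: "qform T v = \<mu> * (v \<bullet> v) - qform S v" if "v \<in> carrier_vec n" for v
    unfolding T_def using that S by (simp add: qform_mat_minus[of _ n] qform_mat_smult[of _ n] qform_one)
  have "\<exists>v \<in> carrier_vec n. T *\<^sub>v v = 0\<^sub>v n \<and> v \<noteq> 0\<^sub>v n"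
  proof (rule ccontr)
    assume "\<not> ?thesis"
    then obtain c where c: "c > 0" "\<And>v. v \<in> carrier_vec n \<Longrightarrow> c * (v \<bullet> v) \<le> qform T v"
      using psd_injective_coercive[OF symT] qT le0 by (metis diff_ge_0_iff_ge)
    have "\<mu> \<le> \<mu> - c" unfolding \<mu>_def
    proof (rule cSup_least[OF ne])
      fix t assume "t \<in> U"
      then show "t \<le> Sup U - c" unfolding U_def \<mu>_def[unfolded U_def, symmetric]
        using c(2) qT by force
    qed
    then show False using c by simp
  qed
  then obtain v where v: "v \<in> carrier_vec n" "v \<noteq> 0\<^sub>v n" "T *\<^sub>v v = 0\<^sub>v n" by blast
  have "T *\<^sub>v v = \<mu> \<cdot>\<^sub>v v - S *\<^sub>v v" unfolding T_def using v S
    by (simp add: minus_mult_distrib_mat_vec[of _ n n] smult_mat_mult_vec[of _ n n])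
  then have "(\<mu> \<cdot>\<^sub>v v - S *\<^sub>v v) $ i = 0" if "i < n" for i
    using v(3) that index_zero_vec(1)[OF that] by metis
  then have "S *\<^sub>v v = \<mu> \<cdot>\<^sub>v v" using v(1) S by (intro eq_vecI) auto
  then have "eigenvalue S \<mu>" using v S unfolding eigenvalue_def eigenvector_def by auto
  then show thesis using that le0 by blast
qed

text \<open>\<open>rayleigh_max\<close> for -S, with the sign of the eigenvalue turned back.\<close>

lemma rayleigh_min:
  assumes sym: "sym_mat n S" and n: "0 < n"
  obtains \<mu> where "eigenvalue S \<mu>" "\<And>v. v \<in> carrier_vec n \<Longrightarrow> \<mu> * (v \<bullet> v) \<le> qform S v"
proof -
  have S: "S \<in> carrier_mat n n" using sym by (simp add: sym_mat_def)
  obtain \<mu> where \<mu>: "eigenvalue ((-1) \<cdot>\<^sub>m S) \<mu>"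
    "\<And>v. v \<in> carrier_vec n \<Longrightarrow> qform ((-1) \<cdot>\<^sub>m S) v \<le> \<mu> * (v \<bullet> v)"
    using rayleigh_max[OF sym_mat_smult[OF sym] n] by blast
  obtain v where v: "v \<in> carrier_vec n" "v \<noteq> 0\<^sub>v n" "((-1) \<cdot>\<^sub>m S) *\<^sub>v v = \<mu> \<cdot>\<^sub>v v"
    using \<mu>(1) S unfolding eigenvalue_def eigenvector_def by auto
  have "S *\<^sub>v v = (-1) \<cdot>\<^sub>v (((-1) \<cdot>\<^sub>m S) *\<^sub>v v)" using S v(1)
    by (simp add: smult_mat_mult_vec[of _ n n] smult_smult_assoc)
  then have "S *\<^sub>v v = (- \<mu>) \<cdot>\<^sub>v v" unfolding v(3) by (simp add: smult_smult_assoc)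
  then have "eigenvalue S (- \<mu>)" using v S unfolding eigenvalue_def eigenvector_def by auto
  moreover have "- \<mu> * (v \<bullet> v) \<le> qform S v" if "v \<in> carrier_vec n" for v
    using \<mu>(2)[OF that] by (simp add: qform_mat_smult[OF S that])
  ultimately show thesis using that by blast
qed

text \<open>For symmetric S the matrix in the definition is S * S, whose eigenvalue \<mu>^2 has root
  \<bar>\<mu>\<bar>. Finiteness and this one membership are enough to compare \<bar>\<mu>\<bar> with
  \<open>Max\<close> and \<open>Min\<close>.\<close>

lemma singular_value_sym:
  assumes sym: "sym_mat n S" and ev: "eigenvalue S \<mu>"
  shows "finite (singular_values S)" "\<bar>\<mu>\<bar> \<in> singular_values S"
proof -
  have S: "S \<in> carrier_mat n n" "S\<^sup>T = S" using sym by (auto simp: sym_mat_def)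
  have SS: "S * S \<in> carrier_mat n n" using S by simp
  show "finite (singular_values S)" unfolding singular_values_def S(2)
    using card_finite_spectrum(1)[OF SS] by (simp add: spectrum_def)
  obtain v where v: "v \<in> carrier_vec n" "v \<noteq> 0\<^sub>v n" "S *\<^sub>v v = \<mu> \<cdot>\<^sub>v v"
    using ev S unfolding eigenvalue_def eigenvector_def by auto
  have "(S * S) *\<^sub>v v = \<mu>\<^sup>2 \<cdot>\<^sub>v v" using S v
    by (simp add: mult_mat_vec[OF S(1) v(1)] smult_smult_assoc power2_eq_square assoc_mult_mat_vec[of _ n n _ n])
  then have "eigenvalue (S * S) (\<mu>\<^sup>2)" using v S unfolding eigenvalue_def eigenvector_def by auto
  then have "sqrt (\<mu>\<^sup>2) \<in> singular_values S" unfolding singular_values_def S(2) by blast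
  then show "\<bar>\<mu>\<bar> \<in> singular_values S" by simp
qed

lemma qform_le_sigma_max:
  assumes sym: "sym_mat n S" and n: "0 < n" and v: "v \<in> carrier_vec n"
  shows "qform S v \<le> sigma_max S * (v \<bullet> v)" "0 \<le> sigma_max S"
proof -
  obtain \<mu> where \<mu>: "eigenvalue S \<mu>" "\<And>v. v \<in> carrier_vec n \<Longrightarrow> qform S v \<le> \<mu> * (v \<bullet> v)"
    using rayleigh_max[OF sym n] by blast
  have "\<bar>\<mu>\<bar> \<le> sigma_max S" unfolding sigma_max_def
    using singular_value_sym[OF sym \<mu>(1)] by simp
  then have *: "\<mu> \<le> sigma_max S" "0 \<le> sigma_max S" by auto
  show "0 \<le> sigma_max S" by fact
  show "qform S v \<le> sigma_max S * (v \<bullet> v)"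
    using \<mu>(2)[OF v] mult_right_mono[OF *(1) scalar_prod_self_nonneg[of v]] by simp
qed

text \<open>The lower bound has to pass from \<bar>\<mu>\<bar> to the least eigenvalue \<mu> itself,
  which requires a nonnegative form. The upper bound gets by with \<mu> \<le> \<bar>\<mu>\<bar> and
  holds for indefinite S.\<close>

lemma sigma_min_le_qform:
  assumes sym: "sym_mat n S" and n: "0 < n" and psd: "\<And>v. v \<in> carrier_vec n \<Longrightarrow> 0 \<le> qform S v"
    and v: "v \<in> carrier_vec n"
  shows "sigma_min S * (v \<bullet> v) \<le> qform S v"
proof -
  obtain \<mu> where \<mu>: "eigenvalue S \<mu>" "\<And>v. v \<in> carrier_vec n \<Longrightarrow> \<mu> * (v \<bullet> v) \<le> qform S v"
    using rayleigh_min[OF sym n] by blast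
  obtain w where w: "w \<in> carrier_vec n" "w \<noteq> 0\<^sub>v n" "S *\<^sub>v w = \<mu> \<cdot>\<^sub>v w"
    using \<mu>(1) sym unfolding eigenvalue_def eigenvector_def sym_mat_def by auto
  have "0 \<le> \<mu> * (w \<bullet> w)" using psd[OF w(1)] w by (simp add: qform_def)
  then have "0 \<le> \<mu>" using scalar_prod_self_pos[OF w(1,2)] by (simp add: zero_le_mult_iff)
  moreover have "sigma_min S \<le> \<bar>\<mu>\<bar>" unfolding sigma_min_def
    using singular_value_sym[OF sym \<mu>(1)] by simp
  ultimately have "sigma_min S \<le> \<mu>" by simp
  then show ?thesis
    using \<mu>(2)[OF v] mult_right_mono[OF _ scalar_prod_self_nonneg[of v], of "sigma_min S" \<mu>] by simp
qed

section \<open>Spectral radius and Lyapunov inequalities\<close>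

text \<open>Real form of a dominant complex eigenpair: with w = a + i b and l = x + i y, the two
  equations are the real and imaginary parts of N w = l w. This makes the spectral radius accessible
  to real quadratic forms.\<close>

lemma rho_eigenvector:
  assumes N: "N \<in> carrier_mat n n" and n: "0 < n"
  obtains a b x y where "a \<in> carrier_vec n" "b \<in> carrier_vec n" "a \<noteq> 0\<^sub>v n \<or> b \<noteq> 0\<^sub>v n"
    "N *\<^sub>v a = x \<cdot>\<^sub>v a - y \<cdot>\<^sub>v b" "N *\<^sub>v b = y \<cdot>\<^sub>v a + x \<cdot>\<^sub>v b" "(rho N)\<^sup>2 = x\<^sup>2 + y\<^sup>2" "0 \<le> rho N"
proof -
  let ?C = "map_mat complex_of_real N"
  have C: "?C \<in> carrier_mat n n" using N by simp
  obtain l where l: "eigenvalue ?C l" "rho N = norm l"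
    using spectral_radius_mem_max(1)[OF C n] unfolding rho_def spectrum_def by auto
  obtain w where w: "w \<in> carrier_vec n" "w \<noteq> 0\<^sub>v n" "?C *\<^sub>v w = l \<cdot>\<^sub>v w"
    using l(1) C unfolding eigenvalue_def eigenvector_def by auto
  define a where "a = map_vec Re w"
  define b where "b = map_vec Im w"
  have ab: "a \<in> carrier_vec n" "b \<in> carrier_vec n" using w unfolding a_def b_def by auto
  have wi: "(\<Sum>j<n. complex_of_real (N $$ (i, j)) * w $ j) = l * w $ i" if i: "i < n" for i
  proof -
    have "(?C *\<^sub>v w) $ i = (l \<cdot>\<^sub>v w) $ i" by (simp add: w)
    then show ?thesis using i N w(1) by (simp add: scalar_prod_def atLeast0LessThan)
  qed
  have eq_a: "N *\<^sub>v a = Re l \<cdot>\<^sub>v a - Im l \<cdot>\<^sub>v b"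
  proof (rule eq_vecI)
    fix i assume "i < dim_vec (Re l \<cdot>\<^sub>v a - Im l \<cdot>\<^sub>v b)"
    then have i: "i < n" using ab by simp
    show "(N *\<^sub>v a) $ i = (Re l \<cdot>\<^sub>v a - Im l \<cdot>\<^sub>v b) $ i"
      using arg_cong[OF wi[OF i], of Re] i N ab w(1)
      by (simp add: scalar_prod_def atLeast0LessThan a_def b_def)
  qed (use N ab in auto)
  have eq_b: "N *\<^sub>v b = Im l \<cdot>\<^sub>v a + Re l \<cdot>\<^sub>v b"
  proof (rule eq_vecI)
    fix i assume "i < dim_vec (Im l \<cdot>\<^sub>v a + Re l \<cdot>\<^sub>v b)"
    then have i: "i < n" using ab by simp
    show "(N *\<^sub>v b) $ i = (Im l \<cdot>\<^sub>v a + Re l \<cdot>\<^sub>v b) $ i"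
      using arg_cong[OF wi[OF i], of Im] i N ab w(1)
      by (simp add: scalar_prod_def atLeast0LessThan a_def b_def)
  qed (use N ab in auto)
  have "a \<noteq> 0\<^sub>v n \<or> b \<noteq> 0\<^sub>v n"
  proof (rule ccontr)
    assume "\<not> ?thesis"
    then have z: "a = 0\<^sub>v n" "b = 0\<^sub>v n" by auto
    have "w $ i = 0" if "i < n" for i
      using arg_cong[OF z(1), of "\<lambda>v. v $ i"] arg_cong[OF z(2), of "\<lambda>v. v $ i"] that w(1)
      by (simp add: a_def b_def complex_eq_iff)
    then show False using w by (metis carrier_vecD eq_vecI index_zero_vec)
  qed
  then show thesis using that[OF ab _ eq_a eq_b] l(2) by (simp add: cmod_power2)
qed

(* On the real and imaginary parts of an eigenvector for a dominant eigenvalue the form P is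
   multiplied by the squared modulus of that eigenvalue, the cross terms cancelling. *)
lemma lyapunov_rho_less:
  assumes N: "N \<in> carrier_mat n n" and n: "0 < n" and P: "sym_mat n P" and g: "0 < g"
    and nonneg: "\<And>v. v \<in> carrier_vec n \<Longrightarrow> 0 \<le> qform P v"
    and less: "\<And>v. v \<in> carrier_vec n \<Longrightarrow> v \<noteq> 0\<^sub>v n \<Longrightarrow> g\<^sup>2 * qform P (N *\<^sub>v v) < qform P v"
  shows "g * rho N < 1"
proof -
  obtain a b x y where ab: "a \<in> carrier_vec n" "b \<in> carrier_vec n" "a \<noteq> 0\<^sub>v n \<or> b \<noteq> 0\<^sub>v n"
    and eq: "N *\<^sub>v a = x \<cdot>\<^sub>v a - y \<cdot>\<^sub>v b" "N *\<^sub>v b = y \<cdot>\<^sub>v a + x \<cdot>\<^sub>v b"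
    and r: "(rho N)\<^sup>2 = x\<^sup>2 + y\<^sup>2" "0 \<le> rho N"
    using rho_eigenvector[OF N n] by metis
  have Pc: "P \<in> carrier_mat n n" using P by (simp add: sym_mat_def)
  have ba: "b \<bullet> (P *\<^sub>v a) = a \<bullet> (P *\<^sub>v b)" using sym_mat_swap[OF P ab(2,1)] .
  have "qform P (N *\<^sub>v a) = x\<^sup>2 * qform P a - 2 * x * y * (a \<bullet> (P *\<^sub>v b)) + y\<^sup>2 * qform P b"
    unfolding eq using ab Pc by (simp add: qform_minus[OF P] qform_smult[OF Pc] mult_mat_vec[OF Pc])
  moreover have "qform P (N *\<^sub>v b) = y\<^sup>2 * qform P a + 2 * x * y * (a \<bullet> (P *\<^sub>v b)) + x\<^sup>2 * qform P b"
    unfolding eq using ab Pc by (simp add: qform_add[OF P] qform_smult[OF Pc] mult_mat_vec[OF Pc])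
  ultimately have s: "qform P (N *\<^sub>v a) + qform P (N *\<^sub>v b) = (rho N)\<^sup>2 * (qform P a + qform P b)"
    unfolding r by (simp add: algebra_simps)
  \<comment> \<open>Only one of a and b is known to be nonzero; the strict inequality is used there
    and this nonstrict one for the other.\<close>
  have le: "g\<^sup>2 * qform P (N *\<^sub>v v) \<le> qform P v" if "v \<in> carrier_vec n" for v
    using less[OF that] that
    by (cases "v = 0\<^sub>v n") (auto simp: mat_mult_zero_vec[OF N] qform_zero[OF Pc])
  have "g\<^sup>2 * qform P (N *\<^sub>v a) + g\<^sup>2 * qform P (N *\<^sub>v b) < qform P a + qform P b"
    using ab less le by (metis add_le_less_mono add_less_le_mono)
  then have *: "(g * rho N)\<^sup>2 * (qform P a + qform P b) < 1 * (qform P a + qform P b)"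
    using s by (simp add: power_mult_distrib mult.assoc flip: distrib_left)
  have "(g * rho N)\<^sup>2 < 1" using mult_right_less_imp_less[OF *] nonneg ab by simp
  then show ?thesis by (simp add: power_less_one_iff abs_square_less_1)
qed

lemma rho_nonneg: "N \<in> carrier_mat n n \<Longrightarrow> 0 < n \<Longrightarrow> 0 \<le> rho N"
  using rho_eigenvector by metis

section \<open>Decay of the powers of a stable matrix\<close>

text \<open>An inequality suffices, because its purpose is to bring the spectral radius of a scaled
  matrix below 1. Dividing a dominant eigenvalue of c N by c gives an eigenvalue of N.\<close>

lemma rho_smult_le:
  assumes N: "N \<in> carrier_mat n n" and n: "0 < n" and c: "0 < c"
  shows "rho (c \<cdot>\<^sub>m N) \<le> c * rho N"
proof -
  let ?N = "map_mat complex_of_real N" and ?cN = "map_mat complex_of_real (c \<cdot>\<^sub>m N)"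
  have C: "?N \<in> carrier_mat n n" "?cN \<in> carrier_mat n n" using N by auto
  obtain l where l: "eigenvalue ?cN l" "rho (c \<cdot>\<^sub>m N) = norm l"
    using spectral_radius_mem_max(1)[OF C(2) n] unfolding rho_def spectrum_def by auto
  obtain w where w: "w \<in> carrier_vec n" "w \<noteq> 0\<^sub>v n" "?cN *\<^sub>v w = l \<cdot>\<^sub>v w"
    using l(1) C unfolding eigenvalue_def eigenvector_def by auto
  have "?N *\<^sub>v w = (l / c) \<cdot>\<^sub>v w"
  proof (rule eq_vecI)
    fix i assume "i < dim_vec ((l / c) \<cdot>\<^sub>v w)"
    then have i: "i < n" using w by simp
    have "(?cN *\<^sub>v w) $ i = (l \<cdot>\<^sub>v w) $ i" by (simp add: w)
    then have "c * (?N *\<^sub>v w) $ i = l * w $ i"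
      using i N w(1) by (simp add: scalar_prod_def sum_distrib_left mult.assoc)
    then show "(?N *\<^sub>v w) $ i = ((l / c) \<cdot>\<^sub>v w) $ i" using i w(1) c by (simp add: field_simps)
  qed (use N w in auto)
  then have "eigenvalue ?N (l / c)" using w C unfolding eigenvalue_def eigenvector_def by auto
  then have "norm (l / c) \<le> rho N"
    using spectral_radius_mem_max(2)[OF C(1) n] unfolding rho_def spectrum_def by auto
  then show ?thesis using l(2) c by (simp add: norm_divide field_simps)
qed

(* Powers of c N are bounded for some c > 1 with c rho N < 1, whence N^k decays like c^(-k). *)
lemma pow_mat_tendsto_zero:
  assumes N: "N \<in> carrier_mat n n" and n: "0 < n" and r: "rho N < 1" and ij: "i < n" "j < n"
  shows "(\<lambda>k. (N ^\<^sub>m k) $$ (i, j)) \<longlonglongrightarrow> 0"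
proof -
  \<comment> \<open>Midpoint between 1 and \<open>1 / rho N\<close>. For \<open>rho N = 0\<close>
    any number above 1 works, whereas the formula would return 1/2 since division by 0 gives
    0.\<close>
  define c where "c = (if rho N = 0 then 2 else (1 + 1 / rho N) / 2)"
  have rN: "0 \<le> rho N" using rho_nonneg[OF N n] .
  have c: "c > 1" "c * rho N < 1" using rN r by (auto simp: c_def field_simps)
  let ?C = "map_mat complex_of_real (c \<cdot>\<^sub>m N)"
  have C: "?C \<in> carrier_mat n n" using N by simp
  have "spectral_radius ?C < 1" using rho_smult_le[OF N n, of c] c unfolding rho_def by linarith
  from spectral_radius_jnf_norm_bound_less_1_upper_triangular[OF C this]
  obtain b where b: "\<And>k. norm_bound (?C ^\<^sub>m k) b" by blast
  have pow: "(c \<cdot>\<^sub>m N) ^\<^sub>m k = c ^ k \<cdot>\<^sub>m (N ^\<^sub>m k)" for k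
  proof (induction k)
    case (Suc k)
    have Nk: "N ^\<^sub>m k \<in> carrier_mat n n" using N by simp
    show ?case using N Nk
      by (simp add: Suc mult_smult_assoc_mat[OF Nk, of "c \<cdot>\<^sub>m N" n] mult_smult_distrib[OF Nk N])
        (auto intro!: eq_matI)
  qed (auto intro!: eq_matI)
  have Cpow: "?C ^\<^sub>m k = map_mat complex_of_real (c ^ k \<cdot>\<^sub>m (N ^\<^sub>m k))" for k
    unfolding pow[symmetric] using N by (simp add: of_real_hom.mat_hom_pow[of _ n])
  have bound: "norm ((N ^\<^sub>m k) $$ (i, j)) \<le> b * (1 / c) ^ k" for k
  proof -
    have Nk: "N ^\<^sub>m k \<in> carrier_mat n n" using N by simp
    have "norm ((?C ^\<^sub>m k) $$ (i, j)) \<le> b"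
      using b[of k] ij C unfolding norm_bound_def by (metis pow_carrier_mat carrier_matD)
    then have "c ^ k * \<bar>(N ^\<^sub>m k) $$ (i, j)\<bar> \<le> b"
      unfolding Cpow using ij N c by (simp add: norm_mult norm_power)
    then show ?thesis using c by (simp add: power_one_over field_simps)
  qed
  have "(\<lambda>k. b * (1 / c) ^ k) \<longlonglongrightarrow> b * 0"
    by (intro tendsto_intros LIMSEQ_power_zero) (use c in auto)
  moreover have "norm ((N ^\<^sub>m k) $$ (i, j)) \<le> norm (b * (1 / c) ^ k) * 1" for k
    using bound[of k] abs_ge_self[of "b * (1 / c) ^ k"] unfolding real_norm_def by linarith
  ultimately show ?thesis by (auto intro!: tendsto_0_le[of "\<lambda>k. b * (1 / c) ^ k" _ _ 1, OF _ always_eventually])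
qed

lemma pow_mat_vec_tendsto_zero:
  assumes N: "N \<in> carrier_mat n n" and n: "0 < n" and r: "rho N < 1" and v: "v \<in> carrier_vec n"
  shows "(\<lambda>k. (N ^\<^sub>m k *\<^sub>v v) \<bullet> (N ^\<^sub>m k *\<^sub>v v)) \<longlonglongrightarrow> 0"
proof -
  have "(\<lambda>k. (N ^\<^sub>m k *\<^sub>v v) $ i) \<longlonglongrightarrow> 0" if i: "i < n" for i
  proof -
    have "(N ^\<^sub>m k *\<^sub>v v) $ i = (\<Sum>j<n. (N ^\<^sub>m k) $$ (i, j) * v $ j)" for k
    proof -
      have "N ^\<^sub>m k \<in> carrier_mat n n" using N by simp
      then show ?thesis using v i N by (simp add: scalar_prod_def atLeast0LessThan)
    qed
    moreover have "(\<lambda>k. \<Sum>j<n. (N ^\<^sub>m k) $$ (i, j) * v $ j) \<longlonglongrightarrow> (\<Sum>j<n. 0 * v $ j)"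
      by (intro tendsto_sum tendsto_mult_right pow_mat_tendsto_zero[OF N n r i]) auto
    ultimately show ?thesis by simp
  qed
  then have "(\<lambda>k. \<Sum>i<n. (N ^\<^sub>m k *\<^sub>v v) $ i * (N ^\<^sub>m k *\<^sub>v v) $ i) \<longlonglongrightarrow> (\<Sum>i<n. 0 * 0)"
    by (intro tendsto_sum tendsto_mult) auto
  moreover have "dim_vec (N ^\<^sub>m k *\<^sub>v v) = n" for k
    using N by (metis carrier_matD(1) dim_mult_mat_vec pow_carrier_mat)
  ultimately show ?thesis by (simp add: scalar_prod_def atLeast0LessThan)
qed

lemma qform_pow_tendsto_zero:
  assumes N: "N \<in> carrier_mat n n" and n: "0 < n" and r: "rho N < 1" and v: "v \<in> carrier_vec n"
    and D: "D \<in> carrier_mat n n"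
  shows "(\<lambda>k. qform D (N ^\<^sub>m k *\<^sub>v v)) \<longlonglongrightarrow> 0"
proof -
  obtain C where C: "C > 0" "\<And>v. v \<in> carrier_vec n \<Longrightarrow> \<bar>qform D v\<bar> \<le> C * (v \<bullet> v)"
    using qform_bound[OF D] by blast
  have "(\<lambda>k. C * ((N ^\<^sub>m k *\<^sub>v v) \<bullet> (N ^\<^sub>m k *\<^sub>v v))) \<longlonglongrightarrow> C * 0"
    by (intro tendsto_intros pow_mat_vec_tendsto_zero[OF N n r v])
  moreover have "norm (qform D (N ^\<^sub>m k *\<^sub>v v))
    \<le> norm (C * ((N ^\<^sub>m k *\<^sub>v v) \<bullet> (N ^\<^sub>m k *\<^sub>v v))) * 1" for k
  proof -
    have "N ^\<^sub>m k *\<^sub>v v \<in> carrier_vec n" using N v by (metis mult_mat_vec_carrier pow_carrier_mat)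
    then show ?thesis
      using C(2)[of "N ^\<^sub>m k *\<^sub>v v"] abs_ge_self[of "C * ((N ^\<^sub>m k *\<^sub>v v) \<bullet> (N ^\<^sub>m k *\<^sub>v v))"]
      unfolding real_norm_def by linarith
  qed
  ultimately show ?thesis
    by (auto intro!: tendsto_0_le[of "\<lambda>k. C * ((N ^\<^sub>m k *\<^sub>v v) \<bullet> (N ^\<^sub>m k *\<^sub>v v))" _ _ 1, OF _ always_eventually])
qed

section \<open>Comparison principle for Lyapunov inequalities\<close>

text \<open>Along the orbit of v the form of D never increases, and it tends to 0 because N is
  stable; hence it cannot start below 0. Taking for D a difference of two value matrices orders
  them.\<close>

lemma lyapunov_comparison:
  assumes N: "N \<in> carrier_mat n n" and n: "0 < n" and r: "rho N < 1" and D: "D \<in> carrier_mat n n"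
    and le: "\<And>v. v \<in> carrier_vec n \<Longrightarrow> qform D (N *\<^sub>v v) \<le> qform D v"
    and v: "v \<in> carrier_vec n"
  shows "0 \<le> qform D v"
proof (rule LIMSEQ_le_const2[OF qform_pow_tendsto_zero[OF N n r v D]], intro exI allI impI)
  fix k
  show "qform D (N ^\<^sub>m k *\<^sub>v v) \<le> qform D v"
    using v
  proof (induction k arbitrary: v)
    case (Suc k)
    have "N ^\<^sub>m Suc k *\<^sub>v v = N ^\<^sub>m k *\<^sub>v (N *\<^sub>v v)" using N Suc.prems by (simp add: assoc_mult_mat_vec[of _ n n _ n])
    then show ?case using Suc.IH[of "N *\<^sub>v v"] le[OF Suc.prems] N Suc.prems by force
  qed (use N in simp)
qed

text \<open>A form that is constant along an orbit and tends to 0 there must vanish. This supplies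
  the injectivity on which policy evaluation rests.\<close>

lemma lyapunov_unique:
  assumes N: "N \<in> carrier_mat n n" and n: "0 < n" and r: "rho N < 1" and D: "D \<in> carrier_mat n n"
    and eq: "\<And>v. v \<in> carrier_vec n \<Longrightarrow> qform D (N *\<^sub>v v) = qform D v"
    and v: "v \<in> carrier_vec n"
  shows "qform D v = 0"
proof -
  have "qform D (N ^\<^sub>m k *\<^sub>v v) = qform D v" for k
    using v
  proof (induction k arbitrary: v)
    case (Suc k)
    have "N ^\<^sub>m Suc k *\<^sub>v v = N ^\<^sub>m k *\<^sub>v (N *\<^sub>v v)" using N Suc.prems by (simp add: assoc_mult_mat_vec[of _ n n _ n])
    then show ?case using Suc.IH[of "N *\<^sub>v v"] eq[OF Suc.prems] N Suc.prems by force
  qed (use N in simp)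
  then show ?thesis using qform_pow_tendsto_zero[OF N n r v D] by (simp add: LIMSEQ_const_iff)
qed

(* The bound on g' makes g'^2 N^T P N < P: sigma_max dominates the form of S, which dominates
   g^2 N^T P N, and sigma_min is dominated by the form of W, where S + W = P. *)
lemma lyapunov_sigma_margin:
  assumes N: "N \<in> carrier_mat n n" and n: "0 < n" and P: "sym_mat n P" and W: "sym_pos_def n W"
    and psd: "\<forall>v\<in>carrier_vec n. 0 \<le> qform P v" and g: "0 < g" "g < g'"
    and le: "\<And>v. v \<in> carrier_vec n \<Longrightarrow> g\<^sup>2 * qform P (N *\<^sub>v v) + qform W v \<le> qform P v"
    and S: "S = P - W"
    and g': "g' < g * sqrt (sigma_min W / sigma_max S + 1)"
  shows "g' * rho N < 1"
proof (rule lyapunov_rho_less[OF N n P])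
  show "0 < g'" using g by simp
  fix v :: "real vec" assume v: "v \<in> carrier_vec n"
  show "0 \<le> qform P v" using psd v by blast
next
  fix v :: "real vec" assume v: "v \<in> carrier_vec n" "v \<noteq> 0\<^sub>v n"
  let ?r = "sigma_min W / sigma_max S"
  have symW: "sym_mat n W" using W by (simp add: sym_pos_def_def)
  have symS: "sym_mat n S" unfolding S by (intro sym_mat_minus P symW)
  have vv: "0 < v \<bullet> v" using scalar_prod_self_pos[OF v] .
  have qS: "qform S v = qform P v - qform W v"
    unfolding S using qform_mat_minus[OF sym_mat_carrier[OF P] sym_mat_carrier[OF symW] v(1)] .
  \<comment> \<open>A number strictly between g and the bound exists only if the ratio is positive,
    so the choice of g' itself guarantees \<open>0 < ?r\<close>.\<close>
  have "g * 1 < g * sqrt (?r + 1)" using g g' by linarith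
  then have "1 < sqrt (?r + 1)" using g by (simp only: mult_less_cancel_left_pos)
  then have r: "0 < ?r" by simp
  have "g' ^ 2 < (g * sqrt (?r + 1)) ^ 2" using g g' by (intro power_strict_mono) auto
  then have g2: "g'\<^sup>2 < g\<^sup>2 * (?r + 1)" using r by (simp add: power_mult_distrib)
  \<comment> \<open>With \<open>sigma_max S = 0\<close> the quotient would be 0 by the convention
    for division, and no g' could have been chosen.\<close>
  have smax: "0 < sigma_max S"
    using qform_le_sigma_max(2)[OF symS n v(1)] r by (cases "sigma_max S = 0") auto
  have nn: "0 \<le> qform P (N *\<^sub>v v)" using psd N v by simp
  have W0: "0 < qform W v" using pos_def_pos[OF W] v by blast
  have a: "g\<^sup>2 * qform P (N *\<^sub>v v) \<le> qform S v" using le[OF v(1)] qS by simp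
  have "?r * qform S v \<le> ?r * (sigma_max S * (v \<bullet> v))"
    using qform_le_sigma_max(1)[OF symS n v(1)] r by (intro mult_left_mono) auto
  also have "\<dots> = sigma_min W * (v \<bullet> v)" using smax by simp
  also have "\<dots> \<le> qform W v"
    by (rule sigma_min_le_qform[OF symW n pos_def_nonneg[OF W] v(1)])
  \<comment> \<open>Adding S to the estimate r S \<le> W and using S + W = P.\<close>
  finally have b: "(?r + 1) * qform S v \<le> qform P v" using qS unfolding distrib_right by linarith
  show "g'\<^sup>2 * qform P (N *\<^sub>v v) < qform P v"
  \<comment> \<open>Enlarging the factor is strict only where the form at N v is nonzero; where it
    vanishes, strictness comes from positivity of W.\<close>
  proof (cases "qform P (N *\<^sub>v v) = 0")
    case True
    then show ?thesis using le[OF v(1)] W0 by simp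
  next
    case False
    then have "g'\<^sup>2 * qform P (N *\<^sub>v v) < g\<^sup>2 * (?r + 1) * qform P (N *\<^sub>v v)"
      using g2 nn by (intro mult_strict_right_mono) auto
    also have "\<dots> = (?r + 1) * (g\<^sup>2 * qform P (N *\<^sub>v v))" by simp
    also have "\<dots> \<le> (?r + 1) * qform S v" using a r by (intro mult_left_mono) auto
    finally show ?thesis using b by simp
  qed
qed

section \<open>Half-vectorization and least squares\<close>

lemma set_upper_pairs: "set (upper_pairs n) = {(i, j). i \<le> j \<and> j < n}"
proof -
  have "set (upper_pairs n) = (\<Union>i<n. Pair i ` {i..<n})" by (simp add: upper_pairs_def atLeast0LessThan)
  then show ?thesis by (auto simp: image_iff)
qed

lemma distinct_upper_pairs: "distinct (upper_pairs n)"
  unfolding upper_pairs_def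
  by (intro distinct_concat) (auto simp: distinct_map inj_on_def upt_conv_Cons)

text \<open>A strictly upper pair stands for itself and for its mirror image, which explains the
  factor 2 in \<open>vecs\<close>.\<close>

lemma sum_upper_pairs:
  fixes f :: "nat \<Rightarrow> nat \<Rightarrow> real"
  assumes "\<And>i j. f i j = f j i"
  shows "(\<Sum>(i, j)\<in>{(i, j). i \<le> j \<and> j < n}. if i = j then f i j else 2 * f i j) = (\<Sum>i<n. \<Sum>j<n. f i j)"
proof -
  let ?U = "{(i, j). i < j \<and> j < n}" and ?L = "{(i, j). j < i \<and> i < n}" and ?D = "{(i, j). i = j \<and> j < n}"
  have fin: "finite {(i, j). i < n \<and> j < n}" by (rule finite_subset[of _ "{..<n} \<times> {..<n}"]) auto
  have f: "finite ?U" "finite ?L" "finite ?D"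
    by (rule finite_subset[OF _ fin]; auto)+
  have L: "(\<Sum>(i, j)\<in>?L. f i j) = (\<Sum>(i, j)\<in>?U. f i j)"
    by (rule sum.reindex_bij_witness[of _ "\<lambda>(i, j). (j, i)" "\<lambda>(i, j). (j, i)"]) (use assms in auto)
  have "{(i, j). i \<le> j \<and> j < n} = ?U \<union> ?D" by auto
  then have "(\<Sum>(i, j)\<in>{(i, j). i \<le> j \<and> j < n}. if i = j then f i j else 2 * f i j)
    = (\<Sum>(i, j)\<in>?U. if i = j then f i j else 2 * f i j) + (\<Sum>(i, j)\<in>?D. if i = j then f i j else 2 * f i j)"
    using f by (simp only:) (rule sum.union_disjoint, auto)
  also have "(\<Sum>(i, j)\<in>?U. if i = j then f i j else 2 * f i j) = (\<Sum>(i, j)\<in>?U. 2 * f i j)"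
    by (intro sum.cong) auto
  also have "\<dots> = (\<Sum>(i, j)\<in>?U. f i j) + (\<Sum>(i, j)\<in>?L. f i j)"
    unfolding L by (simp add: sum_distrib_left case_prod_unfold)
  also have "(\<Sum>(i, j)\<in>?D. if i = j then f i j else 2 * f i j) = (\<Sum>(i, j)\<in>?D. f i j)"
    by (intro sum.cong) auto
  also have "(\<Sum>(i, j)\<in>?U. f i j) + (\<Sum>(i, j)\<in>?L. f i j) = (\<Sum>(i, j)\<in>?U \<union> ?L. f i j)"
    using f by (intro sum.union_disjoint[symmetric]) auto
  also have "(\<Sum>(i, j)\<in>?U \<union> ?L. f i j) + (\<Sum>(i, j)\<in>?D. f i j) = (\<Sum>(i, j)\<in>(?U \<union> ?L) \<union> ?D. f i j)"
    using f by (intro sum.union_disjoint[symmetric]) auto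
  also have "(?U \<union> ?L) \<union> ?D = {..<n} \<times> {..<n}" by auto
  finally show ?thesis by (simp add: sum.cartesian_product)
qed

text \<open>Counted with \<open>sum_upper_pairs\<close> for the constant 1: weight 2 off the
  diagonal and 1 on it adds up to n * n, so twice the length is n * n + n.\<close>

lemma length_upper_pairs: "length (upper_pairs n) = n * (n + 1) div 2"
proof -
  have "2 * real (length (upper_pairs n)) = n * (n + 1)"
  proof -
    have "(\<Sum>(i, j)\<in>{(i, j). i \<le> j \<and> j < n}. if i = j then 1 else 2 * 1) = (\<Sum>i<n. \<Sum>j<n. 1 :: real)"
      by (rule sum_upper_pairs) simp
    moreover have "(\<Sum>(i, j)\<in>{(i, j). i \<le> j \<and> j < n}. if i = j then 1 else 2 * 1 :: real)
      = (\<Sum>(i, j)\<in>{(i, j). i \<le> j \<and> j < n}. 2 - (if i = j then 1 else 0))"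
      by (intro sum.cong) auto
    moreover have "\<dots> = 2 * real (card {(i, j). i \<le> j \<and> j < n}) - (\<Sum>(i, j)\<in>{(i, j). i \<le> j \<and> j < n}. if i = j then 1 else 0)"
      by (simp add: sum_subtractf case_prod_unfold)
    moreover have "(\<Sum>(i, j)\<in>{(i, j). i \<le> j \<and> j < n}. if i = j then 1 else 0 :: real) = n"
    proof -
      have fin: "finite {(i, j). i \<le> j \<and> j < n}" by (metis List.finite_set set_upper_pairs)
      have "(\<Sum>(i, j)\<in>{(i, j). i \<le> j \<and> j < n}. if i = j then 1 else 0 :: real)
        = (\<Sum>(i, j)\<in>(\<lambda>i. (i, i)) ` {..<n}. 1)"
        using fin by (intro sum.mono_neutral_cong_right) auto
      then show ?thesis by (simp add: case_prod_unfold card_image inj_on_def)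
    qed
    moreover have "card {(i, j). i \<le> j \<and> j < n} = length (upper_pairs n)"
      by (metis distinct_card distinct_upper_pairs set_upper_pairs)
    ultimately show ?thesis by (simp add: algebra_simps)
  qed
  then have "2 * length (upper_pairs n) = n * (n + 1)" by (metis of_nat_eq_iff of_nat_mult of_nat_numeral)
  then show ?thesis by linarith
qed

lemma vecs_carrier: "M \<in> carrier_mat n n \<Longrightarrow> vecs M \<in> carrier_vec (n * (n + 1) div 2)"
  by (intro carrier_vecI) (simp add: vecs_def length_upper_pairs del: vec_of_list_map)

lemma vecv_carrier: "v \<in> carrier_vec n \<Longrightarrow> vecv v \<in> carrier_vec (n * (n + 1) div 2)"
  by (intro carrier_vecI) (simp add: vecv_def length_upper_pairs del: vec_of_list_map)

lemma vecv_vecs: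
  assumes M: "sym_mat n M" and v: "v \<in> carrier_vec n"
  shows "vecv v \<bullet> vecs M = qform M v"
proof -
  have Mc: "M \<in> carrier_mat n n" using M by (simp add: sym_mat_def)
  have s: "M $$ (i, j) = M $$ (j, i)" if "i < n" "j < n" for i j
    using M that unfolding sym_mat_def by (metis carrier_matD index_transpose_mat(1))
  \<comment> \<open>Cut off outside the index range, since \<open>sum_upper_pairs\<close> asks for
    symmetry at all naturals while matrix entries are meaningful only inside it.\<close>
  let ?f = "\<lambda>i j. (if i < n \<and> j < n then v $ i * (M $$ (i, j) * v $ j) else 0)"
  have "vecv v \<bullet> vecs M = (\<Sum>k<length (upper_pairs n).
      (case upper_pairs n ! k of (i, j) \<Rightarrow> v $ i * v $ j) *
      (case upper_pairs n ! k of (i, j) \<Rightarrow> if i = j then M $$ (i, j) else 2 * M $$ (i, j)))"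
    using Mc v unfolding vecv_def vecs_def scalar_prod_def
    by (simp add: vec_of_list_index atLeast0LessThan del: vec_of_list_map)
  also have "\<dots> = (\<Sum>p\<in>set (upper_pairs n). (case p of (i, j) \<Rightarrow> v $ i * v $ j) *
      (case p of (i, j) \<Rightarrow> if i = j then M $$ (i, j) else 2 * M $$ (i, j)))"
    by (rule sum.reindex_bij_betw[OF bij_betw_nth[OF distinct_upper_pairs]]) auto
  also have "\<dots> = (\<Sum>(i, j)\<in>{(i, j). i \<le> j \<and> j < n}. if i = j then ?f i j else 2 * ?f i j)"
    unfolding set_upper_pairs by (intro sum.cong) auto
  also have "\<dots> = (\<Sum>i<n. \<Sum>j<n. ?f i j)"
    by (rule sum_upper_pairs) (use s in auto)
  also have "\<dots> = qform M v"
    using Mc v by (simp add: qform_def scalar_prod_def sum_distrib_left atLeast0LessThan)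
  finally show ?thesis .
qed

lemma vecs_inject:
  assumes M: "sym_mat n M" and N: "sym_mat n N" and eq: "vecs M = vecs N"
  shows "M = N"
  using vecv_vecs[OF M] vecv_vecs[OF N] eq by (intro sym_mat_eqI[OF M N]) metis

lemma vecs_surj:
  assumes h: "h \<in> carrier_vec (n * (n + 1) div 2)"
  obtains M where "sym_mat n M" "vecs M = h"
proof -
  have "\<exists>e. \<forall>k<length (upper_pairs n). e (upper_pairs n ! k) = k"
    using distinct_upper_pairs by (intro exI[of _ "the_inv_into {..<length (upper_pairs n)} ((!) (upper_pairs n))"])
      (auto intro!: the_inv_into_f_f inj_on_nth)
  then obtain e where e: "\<And>k. k < length (upper_pairs n) \<Longrightarrow> e (upper_pairs n ! k) = k" by blast
  \<comment> \<open>The number e of a pair is its position in the list. Halving undoes the factor 2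
    of \<open>vecs\<close>, and min and max extend the upper triangle symmetrically.\<close>
  define M where "M = mat n n (\<lambda>(i, j). h $ e (min i j, max i j) / (if i = j then 1 else 2))"
  have "sym_mat n M" unfolding sym_mat_def M_def by (auto intro!: eq_matI simp: min.commute max.commute)
  moreover have "vecs M = h"
  proof (rule eq_vecI)
    fix k assume "k < dim_vec h"
    then have k: "k < length (upper_pairs n)" using h by (simp add: length_upper_pairs)
    obtain i j where ij: "upper_pairs n ! k = (i, j)" by force
    then have "i \<le> j" "j < n" using nth_mem[OF k] set_upper_pairs[of n] by auto
    then show "vecs M $ k = h $ k" using k ij e[OF k] unfolding vecs_def
      by (auto simp: vec_of_list_index M_def min_absorb1 max_absorb2 simp del: vec_of_list_map)
  qed (use h in \<open>simp add: vecs_def M_def length_upper_pairs del: vec_of_list_map\<close>)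
  ultimately show thesis using that by blast
qed

section \<open>Full column rank and exact least squares\<close>

text \<open>Rank counts a maximal independent set of columns, so rank \<open>nc\<close> first forces
  the columns to be pairwise distinct. Only then does independence of the set of columns exclude a
  nontrivial relation with coefficients v.\<close>

lemma full_column_rank_injective:
  fixes G :: "real mat"
  assumes G: "G \<in> carrier_mat m nc" and rank: "vec_space.rank m G = nc"
    and v: "v \<in> carrier_vec nc" "G *\<^sub>v v = 0\<^sub>v m"
  shows "v = 0\<^sub>v nc"
proof (rule ccontr)
  assume ne: "v \<noteq> 0\<^sub>v nc"
  interpret vec_space "TYPE(real)" m .
  obtain S where S: "maximal S (\<lambda>T. T \<subseteq> set (cols G) \<and> lin_indpt T)"
    using maximal_exists_superset[of "set (cols G)" "\<lambda>T. T \<subseteq> set (cols G) \<and> lin_indpt T" "{}"]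
    by (auto simp: lin_dep_def)
  then have "nc \<le> card (set (cols G))"
    using rank_card_indpt[OF G S] rank by (metis (no_types, lifting) List.finite_set card_mono maximal_def)
  then have "distinct (cols G)"
    using G card_length[of "cols G"] by (intro card_distinct) simp
  then show False
    using full_rank_lin_indpt[OF G rank] lin_depI[OF G v(1) ne v(2)] by blast
qed

text \<open>Pairing \<open>(T\<^sup>T * T) *\<^sub>v v\<close> with v gives the squared norm of T v;
  the identity matrix is inserted in the proof to reuse \<open>qform_congruence\<close>.\<close>

lemma normal_matrix_injective:
  fixes T :: "real mat"
  assumes T: "T \<in> carrier_mat m n"
    and inj: "\<And>v. v \<in> carrier_vec n \<Longrightarrow> T *\<^sub>v v = 0\<^sub>v m \<Longrightarrow> v = 0\<^sub>v n"
    and v: "v \<in> carrier_vec n" "(T\<^sup>T * T) *\<^sub>v v = 0\<^sub>v n"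
  shows "v = 0\<^sub>v n"
proof -
  have "0 = v \<bullet> ((T\<^sup>T * 1\<^sub>m m * T) *\<^sub>v v)" using v T by simp
  also have "\<dots> = (T *\<^sub>v v) \<bullet> (T *\<^sub>v v)"
    using qform_congruence[OF T one_carrier_mat v(1)] T v by (simp add: qform_def)
  finally show ?thesis using inj[OF v(1)] scalar_prod_self_zero[of "T *\<^sub>v v" m] T v by simp
qed

text \<open>On a right-hand side in the range of T there is no residual, so the formula acts as a
  left inverse of T.\<close>

lemma least_squares_solution:
  assumes T: "T \<in> carrier_mat m n"
    and inj: "\<And>v. v \<in> carrier_vec n \<Longrightarrow> T *\<^sub>v v = 0\<^sub>v m \<Longrightarrow> v = 0\<^sub>v n"
    and h: "h \<in> carrier_vec n"
  shows "least_squares T (T *\<^sub>v h) = h"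
proof -
  have TT: "T\<^sup>T * T \<in> carrier_mat n n" using T by simp
  note I = minv_inverse[OF TT normal_matrix_injective[OF T inj]]
  have Tt: "T\<^sup>T \<in> carrier_mat n m" using T by simp
  have "least_squares T (T *\<^sub>v h) = minv (T\<^sup>T * T) *\<^sub>v (T\<^sup>T *\<^sub>v (T *\<^sub>v h))"
    unfolding least_squares_def using I(1) T h by (intro assoc_mult_mat_vec[OF _ Tt]) auto
  also have "\<dots> = minv (T\<^sup>T * T) *\<^sub>v ((T\<^sup>T * T) *\<^sub>v h)"
    by (simp only: assoc_mult_mat_vec[OF Tt T h])
  also have "\<dots> = (minv (T\<^sup>T * T) * (T\<^sup>T * T)) *\<^sub>v h"
    by (simp only: assoc_mult_mat_vec[OF I(1) TT h])
  also have "\<dots> = h" by (simp only: I(2) one_mult_mat_vec[OF h])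
  finally show ?thesis .
qed

(* A left inverse G of the injective data matrix Gam turns T into a square matrix that represents
   the operator L on vecs; its injectivity gives surjectivity. *)
lemma least_squares_operator_equation:
  assumes Gam: "Gam \<in> carrier_mat m (n * (n + 1) div 2)"
    and T: "T \<in> carrier_mat m (n * (n + 1) div 2)"
    and Gam_inj: "\<And>v. v \<in> carrier_vec (n * (n + 1) div 2) \<Longrightarrow> Gam *\<^sub>v v = 0\<^sub>v m \<Longrightarrow> v = 0\<^sub>v (n * (n + 1) div 2)"
    and L: "\<And>M. sym_mat n M \<Longrightarrow> sym_mat n (L M)"
    and TL: "\<And>M. sym_mat n M \<Longrightarrow> T *\<^sub>v vecs M = Gam *\<^sub>v vecs (L M)"
    and L_inj: "\<And>M. sym_mat n M \<Longrightarrow> L M = 0\<^sub>m n n \<Longrightarrow> M = 0\<^sub>m n n"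
    and W: "sym_mat n W" and H: "sym_mat n H" and ls: "vecs H = least_squares T (Gam *\<^sub>v vecs W)"
  shows "L H = W"
proof -
  let ?N = "n * (n + 1) div 2"
  have vz: "vecs (0\<^sub>m n n) = 0\<^sub>v ?N"
  proof (rule eq_vecI)
    fix i assume "i < dim_vec (0\<^sub>v ?N)"
    then have i: "i < length (upper_pairs n)" by (simp add: length_upper_pairs)
    then show "vecs (0\<^sub>m n n) $ i = 0\<^sub>v ?N $ i"
      using nth_mem[OF i] set_upper_pairs[of n]
      by (auto simp: vecs_def vec_of_list_index length_upper_pairs simp del: vec_of_list_map)
  qed (simp add: vecs_def length_upper_pairs del: vec_of_list_map)
  have zs: "sym_mat n (0\<^sub>m n n)" by (simp add: sym_mat_def)
  have T_inj: "v = 0\<^sub>v ?N" if v: "v \<in> carrier_vec ?N" "T *\<^sub>v v = 0\<^sub>v m" for v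
  proof -
    obtain M where M: "sym_mat n M" "vecs M = v" using vecs_surj[OF v(1)] .
    have "vecs (L M) = 0\<^sub>v ?N"
      using Gam_inj[of "vecs (L M)"] TL[OF M(1)] vecs_carrier[OF sym_mat_carrier[OF L[OF M(1)]]] v(2) M(2) by simp
    then have "L M = 0\<^sub>m n n" using vecs_inject[OF L[OF M(1)] zs] vz by simp
    then show ?thesis using L_inj[OF M(1)] M(2) vz by simp
  qed
  define G where "G = minv (Gam\<^sup>T * Gam) * Gam\<^sup>T"
  have GG: "Gam\<^sup>T * Gam \<in> carrier_mat ?N ?N" using Gam by simp
  have G: "G \<in> carrier_mat ?N m"
    unfolding G_def using minv_inverse(1)[OF GG normal_matrix_injective[OF Gam Gam_inj]] Gam by simp
  have inv: "G *\<^sub>v (Gam *\<^sub>v h) = h" if "h \<in> carrier_vec ?N" for h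
    using least_squares_solution[OF Gam Gam_inj that] by (simp add: least_squares_def G_def)
  have GT: "G * T \<in> carrier_mat ?N ?N" using G T by simp
  have GT_inj: "v = 0\<^sub>v ?N" if v: "v \<in> carrier_vec ?N" "(G * T) *\<^sub>v v = 0\<^sub>v ?N" for v
  proof -
    obtain M where M: "sym_mat n M" "vecs M = v" using vecs_surj[OF v(1)] .
    have LM: "vecs (L M) \<in> carrier_vec ?N" using vecs_carrier[OF sym_mat_carrier[OF L[OF M(1)]]] .
    have "vecs (L M) = G *\<^sub>v (T *\<^sub>v v)" using inv[OF LM] TL[OF M(1)] M(2) by simp
    also have "\<dots> = 0\<^sub>v ?N" using v assoc_mult_mat_vec[OF G T v(1)] by simp
    finally have "Gam *\<^sub>v vecs (L M) = 0\<^sub>v m" by (simp only: mat_mult_zero_vec[OF Gam])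
    then show ?thesis using T_inj[OF v(1)] TL[OF M(1)] M(2) by simp
  qed
  note I = minv_inverse[OF GT GT_inj]
  have Wc: "vecs W \<in> carrier_vec ?N" using vecs_carrier[OF sym_mat_carrier[OF W]] .
  define h where "h = minv (G * T) *\<^sub>v vecs W"
  have h: "h \<in> carrier_vec ?N" unfolding h_def using I(1) Wc by simp
  obtain M where M: "sym_mat n M" "vecs M = h" using vecs_surj[OF h] .
  have "vecs (L M) = G *\<^sub>v (T *\<^sub>v h)"
    using inv[OF vecs_carrier[OF sym_mat_carrier[OF L[OF M(1)]]]] TL[OF M(1)] M(2) by simp
  also have "\<dots> = (G * T) *\<^sub>v h" by (rule assoc_mult_mat_vec[OF G T h, symmetric])
  also have "\<dots> = (G * T * minv (G * T)) *\<^sub>v vecs W"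
    unfolding h_def by (rule assoc_mult_mat_vec[OF GT I(1) Wc, symmetric])
  also have "\<dots> = vecs W" by (simp only: I(3) one_mult_mat_vec[OF Wc])
  finally have LM: "L M = W" using vecs_inject[OF L[OF M(1)] W] by simp
  \<comment> \<open>Because L M = W, the data vector equals T applied to \<open>vecs M\<close>;
    least squares thus returns \<open>vecs M\<close> exactly, which identifies H with M.\<close>
  have "least_squares T (Gam *\<^sub>v vecs W) = vecs M"
    using least_squares_solution[OF T T_inj h] TL[OF M(1)] LM M(2) by simp
  then show ?thesis using vecs_inject[OF H M(1)] ls LM by simp
qed

section \<open>Policy iteration\<close>

lemma block_Q_function:
  assumes "A \<in> carrier_mat nx nx" "B \<in> carrier_mat nx nu" "Q \<in> carrier_mat nx nx" "R \<in> carrier_mat nu nu"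
    "P \<in> carrier_mat nx nx"
  shows "block_uu nx (Q_function_mat A B Q R P) = B\<^sup>T * P * B + R"
    "block_ux nx (Q_function_mat A B Q R P) = B\<^sup>T * P * A"
  using assms unfolding block_uu_def block_ux_def split_block_def Q_function_mat_def
  by (auto simp: Let_def intro!: eq_matI)

lemma sym_mat_Q_function:
  assumes "A \<in> carrier_mat nx nx" "B \<in> carrier_mat nx nu" "sym_mat nx Q" "sym_mat nu R" "sym_mat nx P"
  shows "sym_mat (nx + nu) (Q_function_mat A B Q R P)"
proof -
  have c: "Q \<in> carrier_mat nx nx" "R \<in> carrier_mat nu nu" "P \<in> carrier_mat nx nx" "P\<^sup>T = P"
    using assms by (auto simp: sym_mat_def)
  have s: "sym_mat nx (A\<^sup>T * P * A + Q)" "sym_mat nu (B\<^sup>T * P * B + R)"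
    using assms by (auto intro!: sym_mat_add sym_mat_congruence)
  have "(A\<^sup>T * P * B)\<^sup>T = B\<^sup>T * (A\<^sup>T * P)\<^sup>T"
    by (rule transpose_mult) (use assms c in auto)
  also have "(A\<^sup>T * P)\<^sup>T = P\<^sup>T * A\<^sup>T\<^sup>T" by (rule transpose_mult) (use assms c in auto)
  also have "B\<^sup>T * (P\<^sup>T * A\<^sup>T\<^sup>T) = B\<^sup>T * P * A"
    using assms c by (simp add: assoc_mult_mat[of _ nu nx _ nx _ nx])
  finally have t: "(A\<^sup>T * P * B)\<^sup>T = B\<^sup>T * P * A" .
  then have "(B\<^sup>T * P * A)\<^sup>T = A\<^sup>T * P * B" by (metis transpose_transpose)
  then show ?thesis
    using t s assms c unfolding sym_mat_def Q_function_mat_def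
    by (subst transpose_four_block_mat[of _ nx nx _ nu _ nu]) auto
qed

text \<open>Bellman form: stage cost plus the value of the successor state, for an arbitrary input
  w. Evaluation, improvement and the Riccati equation all specialise w.\<close>

lemma qform_Q_function:
  assumes A: "A \<in> carrier_mat nx nx" and B: "B \<in> carrier_mat nx nu"
    and Q: "Q \<in> carrier_mat nx nx" and R: "R \<in> carrier_mat nu nu" and P: "P \<in> carrier_mat nx nx"
    and v: "v \<in> carrier_vec nx" and w: "w \<in> carrier_vec nu"
  shows "qform (Q_function_mat A B Q R P) (v @\<^sub>v w) =
    qform Q v + qform R w + qform P (A *\<^sub>v v + B *\<^sub>v w)"
proof -
  have c: "A\<^sup>T * P * A \<in> carrier_mat nx nx" "A\<^sup>T * P * B \<in> carrier_mat nx nu"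
    "B\<^sup>T * P * A \<in> carrier_mat nu nx" "B\<^sup>T * P * B \<in> carrier_mat nu nu"
    using assms by auto
  have d: "(A\<^sup>T * P * A) *\<^sub>v v \<in> carrier_vec nx" "(A\<^sup>T * P * B) *\<^sub>v w \<in> carrier_vec nx"
    "(B\<^sup>T * P * A) *\<^sub>v v \<in> carrier_vec nu" "(B\<^sup>T * P * B) *\<^sub>v w \<in> carrier_vec nu"
    "Q *\<^sub>v v \<in> carrier_vec nx" "R *\<^sub>v w \<in> carrier_vec nu"
    using c v w Q R by (auto intro: mult_mat_vec_carrier)
  have e: "A *\<^sub>v v \<in> carrier_vec nx" "B *\<^sub>v w \<in> carrier_vec nx" using A B v w by auto
  have f: "P *\<^sub>v (A *\<^sub>v v) \<in> carrier_vec nx" "P *\<^sub>v (B *\<^sub>v w) \<in> carrier_vec nx" using P e by auto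
  have "qform (Q_function_mat A B Q R P) (v @\<^sub>v w) =
    v \<bullet> ((A\<^sup>T * P * A + Q) *\<^sub>v v + (A\<^sup>T * P * B) *\<^sub>v w) + w \<bullet> ((B\<^sup>T * P * A) *\<^sub>v v + (B\<^sup>T * P * B + R) *\<^sub>v w)"
    unfolding qform_def Q_function_mat_def
    by (subst four_block_mat_mult_vec[of _ nx nx _ nu _ nu], (use c Q R v w in auto)[6], rule scalar_prod_append[OF v w])
      (intro add_carrier_vec mult_mat_vec_carrier[OF add_carrier_mat[OF Q] v]
        mult_mat_vec_carrier[OF add_carrier_mat[OF R] w] d)+
  also have "\<dots> = (v \<bullet> ((A\<^sup>T * P * A) *\<^sub>v v) + v \<bullet> (Q *\<^sub>v v) + v \<bullet> ((A\<^sup>T * P * B) *\<^sub>v w)) +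
    (w \<bullet> ((B\<^sup>T * P * A) *\<^sub>v v) + (w \<bullet> ((B\<^sup>T * P * B) *\<^sub>v w) + w \<bullet> (R *\<^sub>v w)))"
    unfolding add_mult_distrib_mat_vec[OF c(1) Q v] add_mult_distrib_mat_vec[OF c(4) R w]
    using d v w by (simp add: scalar_prod_add_distrib[of _ nx] scalar_prod_add_distrib[of _ nu]
      del: assoc_mult_mat assoc_mult_mat_vec)
  also have "\<dots> = qform Q v + qform R w + qform P (A *\<^sub>v v + B *\<^sub>v w)"
    unfolding bilinear_congruence[OF A P A v v] bilinear_congruence[OF A P B v w]
      bilinear_congruence[OF B P A w v] bilinear_congruence[OF B P B w w] qform_def
      mult_add_distrib_mat_vec[OF P e] using e f
    by (simp add: scalar_prod_add_distrib[of _ nx] add_scalar_prod_distrib[of _ nx])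
  finally show ?thesis .
qed

lemma sym_mat_value_of:
  assumes "sym_mat (nx + nu) H" "K \<in> carrier_mat nu nx"
  shows "sym_mat nx (value_of nx K H)"
  unfolding value_of_def using assms by (intro sym_mat_congruence[of _ "nx + nu"]) auto

lemma qform_value_of:
  assumes H: "H \<in> carrier_mat (nx + nu) (nx + nu)" and K: "K \<in> carrier_mat nu nx" and v: "v \<in> carrier_vec nx"
  shows "qform (value_of nx K H) v = qform H (v @\<^sub>v - (K *\<^sub>v v))"
proof -
  have M: "1\<^sub>m nx @\<^sub>r (- K) \<in> carrier_mat (nx + nu) nx" using K by auto
  have "(1\<^sub>m nx @\<^sub>r (- K)) *\<^sub>v v = v @\<^sub>v - (K *\<^sub>v v)"
    using mat_mult_append[of "1\<^sub>m nx" nx nx "- K" nu v] K v by simp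
  then show ?thesis unfolding value_of_def using qform_congruence[OF M H v] by simp
qed

section \<open>Greedy gains, the Riccati equation and stability\<close>

text \<open>Restricted to dimensions and definiteness so that it can be instantiated again for the
  scaled pair (g A, g B).\<close>

locale lqr =
  fixes nx nu :: nat and A B Q R :: "real mat"
  assumes nx: "0 < nx"
    and A: "A \<in> carrier_mat nx nx" and B: "B \<in> carrier_mat nx nu"
    and Q: "sym_pos_def nx Q" and R: "sym_pos_def nu R"
begin

lemma sym_Q: "sym_mat nx Q" and sym_R: "sym_mat nu R"
  using Q R by (auto simp: sym_pos_def_def)

lemmas Q_carrier = sym_mat_carrier[OF sym_Q]
lemmas R_carrier = sym_mat_carrier[OF sym_R]

lemma closed_loop_vec:
  assumes K: "K \<in> carrier_mat nu nx" and v: "v \<in> carrier_vec nx"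
  shows "(A - B * K) *\<^sub>v v = A *\<^sub>v v - B *\<^sub>v (K *\<^sub>v v)"
  using A B K v by (subst minus_mult_distrib_mat_vec[of _ nx nx]) auto

lemma closed_loop_carrier: "K \<in> carrier_mat nu nx \<Longrightarrow> A - B * K \<in> carrier_mat nx nx"
  using A B by auto

lemma qform_Q_function_feedback:
  assumes P: "P \<in> carrier_mat nx nx" and v: "v \<in> carrier_vec nx" and w: "w \<in> carrier_vec nu"
  shows "qform (Q_function_mat A B Q R P) (v @\<^sub>v - w) = qform Q v + qform R w + qform P (A *\<^sub>v v - B *\<^sub>v w)"
proof -
  have m: "- w = (-1) \<cdot>\<^sub>v w" using w by auto
  have mw: "- w \<in> carrier_vec nu" using w by simp
  have "qform R (- w) = qform R w" unfolding m using qform_smult[OF R_carrier w, of "-1"] by simp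
  moreover have "A *\<^sub>v v + B *\<^sub>v (- w) = A *\<^sub>v v - B *\<^sub>v w"
    unfolding m mult_mat_vec[OF B w] using A B v w by (intro eq_vecI) auto
  ultimately show ?thesis using qform_Q_function[OF A B Q_carrier R_carrier P v mw] by simp
qed

text \<open>Half the Hessian of the one-step cost in the input. Its P part is only nonnegative; R
  makes it injective, hence invertible.\<close>

lemma control_hessian:
  assumes P: "sym_mat nx P" and psd: "\<forall>v\<in>carrier_vec nx. 0 \<le> qform P v"
  shows "sym_mat nu (B\<^sup>T * P * B + R)"
    and "w \<in> carrier_vec nu \<Longrightarrow> qform (B\<^sup>T * P * B + R) w = qform P (B *\<^sub>v w) + qform R w"
    and "w \<in> carrier_vec nu \<Longrightarrow> (B\<^sup>T * P * B + R) *\<^sub>v w = 0\<^sub>v nu \<Longrightarrow> w = 0\<^sub>v nu"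
proof -
  let ?S = "B\<^sup>T * P * B + R"
  note Pc = sym_mat_carrier[OF P]
  have c: "B\<^sup>T * P * B \<in> carrier_mat nu nu" using Pc B by auto
  show "sym_mat nu ?S" by (intro sym_mat_add sym_mat_congruence[OF B P] sym_R)
  show qS: "qform ?S w = qform P (B *\<^sub>v w) + qform R w" if "w \<in> carrier_vec nu" for w
    using qform_mat_add[OF c R_carrier that] qform_congruence[OF B Pc that] by simp
  show "w = 0\<^sub>v nu" if w: "w \<in> carrier_vec nu" "?S *\<^sub>v w = 0\<^sub>v nu"
  proof (rule ccontr)
    assume "w \<noteq> 0\<^sub>v nu"
    then have "0 < qform R w" using pos_def_pos[OF R] w by blast
    moreover have "0 \<le> qform P (B *\<^sub>v w)" using psd B w by simp
    moreover have "qform ?S w = 0" unfolding qform_def using w by simp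
    ultimately show False using qS[OF w(1)] by simp
  qed
qed

text \<open>Completing the square in w: the equation S K = B^T P A, with S = B^T P B + R, rewrites
  the cross term as w paired with S K v, so that w enters only through w - K v.\<close>

lemma greedy_gain:
  assumes P: "sym_mat nx P" and psd: "\<forall>v\<in>carrier_vec nx. 0 \<le> qform P v"
    and K: "K = gain_of nx (Q_function_mat A B Q R P)"
  shows "K \<in> carrier_mat nu nx"
    and "v \<in> carrier_vec nx \<Longrightarrow> (B\<^sup>T * P * B + R) *\<^sub>v (K *\<^sub>v v) = (B\<^sup>T * P * A) *\<^sub>v v"
    and "v \<in> carrier_vec nx \<Longrightarrow> w \<in> carrier_vec nu \<Longrightarrow>
      qform R w + qform P (A *\<^sub>v v - B *\<^sub>v w) =
      qform P (A *\<^sub>v v) - qform (B\<^sup>T * P * B + R) (K *\<^sub>v v) + qform (B\<^sup>T * P * B + R) (w - K *\<^sub>v v)"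
proof -
  let ?S = "B\<^sup>T * P * B + R"
  note Pc = sym_mat_carrier[OF P]
  have c: "B\<^sup>T * P * A \<in> carrier_mat nu nx" using Pc A B by auto
  note hess = control_hessian[OF P psd]
  note S = hess(1) and qS = hess(2)
  note Sc = sym_mat_carrier[OF S]
  note I = minv_inverse[OF Sc hess(3)]
  have Keq: "K = minv ?S * (B\<^sup>T * P * A)"
    unfolding K gain_of_def block_Q_function[OF A B Q_carrier R_carrier Pc] ..
  show Kc: "K \<in> carrier_mat nu nx" unfolding Keq using I(1) c by (rule mult_carrier_mat)
  have SK: "?S *\<^sub>v (K *\<^sub>v v) = (B\<^sup>T * P * A) *\<^sub>v v" if v: "v \<in> carrier_vec nx" for v
  proof -
    have z: "(B\<^sup>T * P * A) *\<^sub>v v \<in> carrier_vec nu" using c v by (rule mult_mat_vec_carrier)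
    have "?S *\<^sub>v (K *\<^sub>v v) = ?S *\<^sub>v (minv ?S *\<^sub>v ((B\<^sup>T * P * A) *\<^sub>v v))"
      unfolding Keq by (simp only: assoc_mult_mat_vec[OF I(1) c v])
    also have "\<dots> = (?S * minv ?S) *\<^sub>v ((B\<^sup>T * P * A) *\<^sub>v v)"
      by (rule assoc_mult_mat_vec[OF Sc I(1) z, symmetric])
    finally show ?thesis by (simp only: I(3) one_mult_mat_vec[OF z])
  qed
  then show "v \<in> carrier_vec nx \<Longrightarrow> ?S *\<^sub>v (K *\<^sub>v v) = (B\<^sup>T * P * A) *\<^sub>v v" .
  assume v: "v \<in> carrier_vec nx" and w: "w \<in> carrier_vec nu"
  have Kv: "K *\<^sub>v v \<in> carrier_vec nu" using Kc v by simp
  have Av: "A *\<^sub>v v \<in> carrier_vec nx" and Bw: "B *\<^sub>v w \<in> carrier_vec nx" using A B v w by auto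
  have "(A *\<^sub>v v) \<bullet> (P *\<^sub>v (B *\<^sub>v w)) = w \<bullet> (?S *\<^sub>v (K *\<^sub>v v))"
    unfolding SK[OF v] bilinear_congruence[OF B Pc A w v] by (rule sym_mat_swap[OF P Av Bw])
  then show "qform R w + qform P (A *\<^sub>v v - B *\<^sub>v w) =
      qform P (A *\<^sub>v v) - qform ?S (K *\<^sub>v v) + qform ?S (w - K *\<^sub>v v)"
    using qform_minus[OF P Av Bw] qform_minus[OF S w Kv] qS[OF w] by simp
qed

text \<open>The leftover square is weighted by B^T P B + R and is bounded below by its R part. This
  remainder is retained because it later measures the error of the gain.\<close>

lemma greedy_gain_optimal:
  assumes P: "sym_mat nx P" and psd: "\<forall>v\<in>carrier_vec nx. 0 \<le> qform P v"
    and K: "K = gain_of nx (Q_function_mat A B Q R P)"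
    and v: "v \<in> carrier_vec nx" and w: "w \<in> carrier_vec nu"
  shows "qform R (K *\<^sub>v v) + qform P ((A - B * K) *\<^sub>v v) + qform R (w - K *\<^sub>v v)
    \<le> qform R w + qform P (A *\<^sub>v v - B *\<^sub>v w)"
proof -
  let ?S = "B\<^sup>T * P * B + R"
  note G = greedy_gain[OF P psd K]
  note Pc = sym_mat_carrier[OF P]
  have Kv: "K *\<^sub>v v \<in> carrier_vec nu" using G(1) v by simp
  have d: "w - K *\<^sub>v v \<in> carrier_vec nu" using w Kv by simp
  note hess = control_hessian[OF P psd]
  have "0 \<le> qform P (B *\<^sub>v (w - K *\<^sub>v v))" using psd B d by simp
  moreover have "K *\<^sub>v v - K *\<^sub>v v = 0\<^sub>v nu" using Kv by (intro eq_vecI) auto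
  then have "qform ?S (K *\<^sub>v v - K *\<^sub>v v) = 0" using qform_zero[OF sym_mat_carrier[OF hess(1)]] by simp
  ultimately show ?thesis
    using hess(2)[OF d] G(3)[OF v w] G(3)[OF v Kv] closed_loop_vec[OF G(1) v] by simp
qed

text \<open>By S K = B^T P A with S = B^T P B + R, the correction term of the Riccati equation is
  the form of S at K v. Completing the square at w = K v then turns the equation into the Lyapunov
  equation of the closed loop.\<close>

lemma riccati_fixed_point:
  assumes P: "sym_pos_def nx P" and are: "ARE A B Q R P"
  defines "K \<equiv> gain_of nx (Q_function_mat A B Q R P)"
  shows "optimal_gain A B R P = K"
    and "v \<in> carrier_vec nx \<Longrightarrow> qform P v = qform Q v + qform R (K *\<^sub>v v) + qform P ((A - B * K) *\<^sub>v v)"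
proof -
  let ?S = "B\<^sup>T * P * B + R"
  have symP: "sym_mat nx P" using P by (simp add: sym_pos_def_def)
  note Pc = sym_mat_carrier[OF symP]
  have psd: "\<forall>v\<in>carrier_vec nx. 0 \<le> qform P v" using pos_def_nonneg[OF P] by blast
  note G = greedy_gain[OF symP psd K_def[THEN meta_eq_to_obj_eq]]
  have cm: "R + B\<^sup>T * P * B = ?S" using R_carrier B Pc by (intro comm_add_mat) auto
  note hess = control_hessian[OF symP psd]
  note S = hess(1)
  have c: "B\<^sup>T * P * A \<in> carrier_mat nu nx" "B\<^sup>T * P \<in> carrier_mat nu nx" "A\<^sup>T * P * B \<in> carrier_mat nx nu"
    "A\<^sup>T * P * A \<in> carrier_mat nx nx" using Pc A B by auto
  have Si: "minv ?S \<in> carrier_mat nu nu" by (rule minv_inverse(1)[OF sym_mat_carrier[OF S] hess(3)])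
  have Keq: "K = minv ?S * (B\<^sup>T * P * A)"
    unfolding K_def gain_of_def block_Q_function[OF A B Q_carrier R_carrier Pc] ..
  have BtP: "minv ?S * B\<^sup>T * P * A = minv ?S * (B\<^sup>T * P * A)"
    using Si B Pc A by (simp add: assoc_mult_mat[of _ nu nu _ nx _ nx] assoc_mult_mat[of _ nu nx _ nx _ nx])
  show "optimal_gain A B R P = K" unfolding optimal_gain_def cm Keq by (rule BtP)
  have "A\<^sup>T * P * B * minv ?S * B\<^sup>T * P * A = A\<^sup>T * P * B * (minv ?S * B\<^sup>T * P * A)"
  proof -
    have Bt: "B\<^sup>T \<in> carrier_mat nu nx" using B by simp
    have m1: "minv ?S * B\<^sup>T \<in> carrier_mat nu nx" "minv ?S * B\<^sup>T * P \<in> carrier_mat nu nx"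
      using Si Bt Pc by auto
    show ?thesis
      by (simp only: assoc_mult_mat[OF c(3) Si Bt] assoc_mult_mat[OF c(3) m1(1) Pc] assoc_mult_mat[OF c(3) m1(2) A])
  qed
  then have X: "A\<^sup>T * P * B * minv ?S * B\<^sup>T * P * A = A\<^sup>T * P * B * K" by (simp only: BtP Keq)
  have are': "A\<^sup>T * P * A - P - A\<^sup>T * P * B * K = - Q" using are unfolding ARE_def cm X .
  assume v: "v \<in> carrier_vec nx"
  have Kv: "K *\<^sub>v v \<in> carrier_vec nu" using G(1) v by simp
  have Av: "A *\<^sub>v v \<in> carrier_vec nx" and BKv: "B *\<^sub>v (K *\<^sub>v v) \<in> carrier_vec nx" using A B v Kv by auto
  have Xc: "A\<^sup>T * P * B * K \<in> carrier_mat nx nx" using c(3) G(1) by (rule mult_carrier_mat)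
  have "qform (A\<^sup>T * P * B * K) v = v \<bullet> ((A\<^sup>T * P * B) *\<^sub>v (K *\<^sub>v v))"
    unfolding qform_def by (simp only: assoc_mult_mat_vec[OF c(3) G(1) v])
  also have "\<dots> = (K *\<^sub>v v) \<bullet> (?S *\<^sub>v (K *\<^sub>v v))"
    unfolding G(2)[OF v] bilinear_congruence[OF A Pc B v Kv] bilinear_congruence[OF B Pc A Kv v]
    by (rule sym_mat_swap[OF symP Av BKv])
  finally have q: "qform (A\<^sup>T * P * B * K) v = qform ?S (K *\<^sub>v v)" by (simp add: qform_def)
  have "- Q = (-1) \<cdot>\<^sub>m Q" by (intro eq_matI) auto
  then have "qform (- Q) v = - qform Q v" using qform_mat_smult[OF Q_carrier v, of "-1"] by simp
  then have "qform P (A *\<^sub>v v) - qform P v - qform ?S (K *\<^sub>v v) = - qform Q v"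
    unfolding are'[symmetric] using qform_mat_minus[OF minus_carrier_mat[OF Pc] Xc v, of "A\<^sup>T * P * A"]
      qform_mat_minus[OF c(4) Pc v] qform_congruence[OF A Pc v] q c(4) Pc by simp
  moreover have "K *\<^sub>v v - K *\<^sub>v v = 0\<^sub>v nu" using Kv by (intro eq_vecI) auto
  then have "qform ?S (K *\<^sub>v v - K *\<^sub>v v) = 0" using qform_zero[OF sym_mat_carrier[OF S]] by simp
  ultimately show "qform P v = qform Q v + qform R (K *\<^sub>v v) + qform P ((A - B * K) *\<^sub>v v)"
    using G(3)[OF v Kv] closed_loop_vec[OF G(1) v] by simp
qed

lemma lyapunov_pos_def:
  assumes P: "sym_mat nx P" and K: "K \<in> carrier_mat nu nx" and r: "rho (A - B * K) < 1"
    and eq: "\<And>v. v \<in> carrier_vec nx \<Longrightarrow>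
      qform P v = qform Q v + qform R (K *\<^sub>v v) + qform P ((A - B * K) *\<^sub>v v)"
    and v: "v \<in> carrier_vec nx"
  shows "0 \<le> qform P v"
proof (rule lyapunov_comparison[OF closed_loop_carrier[OF K] nx r sym_mat_carrier[OF P] _ v])
  fix v :: "real vec" assume v: "v \<in> carrier_vec nx"
  show "qform P ((A - B * K) *\<^sub>v v) \<le> qform P v"
    using eq[OF v] pos_def_nonneg[OF Q v] pos_def_nonneg[OF R, of "K *\<^sub>v v"] K v by simp
qed

text \<open>Strictness comes from Q, so a merely nonnegative P is enough. Serves both the optimal
  closed loop and the improved gains of the second loop.\<close>

lemma stable_of_lyapunov:
  assumes P: "sym_mat nx P" and psd: "\<forall>v\<in>carrier_vec nx. 0 \<le> qform P v" and K: "K \<in> carrier_mat nu nx"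
    and le: "\<And>v. v \<in> carrier_vec nx \<Longrightarrow>
      qform Q v + qform R (K *\<^sub>v v) + qform P ((A - B * K) *\<^sub>v v) \<le> qform P v"
  shows "rho (A - B * K) < 1"
proof -
  have "1 * rho (A - B * K) < 1"
  proof (rule lyapunov_rho_less[OF closed_loop_carrier[OF K] nx P])
    fix v :: "real vec" assume v: "v \<in> carrier_vec nx" "v \<noteq> 0\<^sub>v nx"
    have "0 < qform Q v" using pos_def_pos[OF Q] v by blast
    then show "1\<^sup>2 * qform P ((A - B * K) *\<^sub>v v) < qform P v"
      using le[OF v(1)] pos_def_nonneg[OF R, of "K *\<^sub>v v"] K v by simp
  qed (use psd in auto)
  then show ?thesis by simp
qed

section \<open>Policy evaluation from data and policy improvement\<close>

text \<open>The data come from the unscaled system. A row of the regression evaluates M at a state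
  and input, minus g^2 times the value form of M at the successor state; full rank removes the
  sampling. Since a form at g z is g^2 times the form at z, the factor moves into the dynamics at
  the end.\<close>

lemma policy_evaluation:
  assumes data: "\<And>l. l \<le> s \<Longrightarrow> x (k l) \<in> carrier_vec nx" "\<And>l. l \<le> s \<Longrightarrow> u (k l) \<in> carrier_vec nu"
      "\<And>l. l \<le> s \<Longrightarrow> x (k l + 1) = A *\<^sub>v x (k l) + B *\<^sub>v u (k l)"
    and rank: "vec_space.rank (s + 1) (Gamma_X nx nu x u k s) = (nx + nu) * (nx + nu + 1) div 2"
    and K: "K \<in> carrier_mat nu nx" and g: "0 < g" "g * rho (A - B * K) < 1"
    and H: "sym_mat (nx + nu) H"
    and ls: "vecs H = least_squares (Gamma_X nx nu x u k s - g\<^sup>2 \<cdot>\<^sub>m Gamma_x nx nu x k s K)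
      (Gamma_X nx nu x u k s *\<^sub>v vecs (Qbar nx nu Q R))"
  shows "H = Q_function_mat (g \<cdot>\<^sub>m A) (g \<cdot>\<^sub>m B) Q R (value_of nx K H)"
proof -
  let ?n = "nx + nu"
  let ?N = "(nx + nu) * (nx + nu + 1) div 2"
  let ?G = "Gamma_X nx nu x u k s"
  let ?T = "?G - g\<^sup>2 \<cdot>\<^sub>m Gamma_x nx nu x k s K"
  let ?V = "value_of nx K"
  \<comment> \<open>A Q-function without stage cost: its form at (v, w) is the value form of M at A
    v + B w.\<close>
  let ?O = "\<lambda>M. Q_function_mat A B (0\<^sub>m nx nx) (0\<^sub>m nu nu) (?V M)"
  let ?L = "\<lambda>M. M - g\<^sup>2 \<cdot>\<^sub>m ?O M"
  have V: "sym_mat nx (?V M)" if "sym_mat ?n M" for M using sym_mat_value_of[OF that K] .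
  have O: "sym_mat ?n (?O M)" if "sym_mat ?n M" for M
    by (rule sym_mat_Q_function[OF A B _ _ V[OF that]]) (auto simp: sym_mat_def)
  have L: "sym_mat ?n (?L M)" if "sym_mat ?n M" for M
    by (intro sym_mat_minus sym_mat_smult that O)
  have qO: "qform (?O M) (v @\<^sub>v w) = qform (?V M) (A *\<^sub>v v + B *\<^sub>v w)"
    if "sym_mat ?n M" "v \<in> carrier_vec nx" "w \<in> carrier_vec nu" for M v w
    using qform_Q_function[OF A B zero_carrier_mat zero_carrier_mat sym_mat_carrier[OF V[OF that(1)]] that(2,3)]
      qform_zero_mat[OF that(2)] qform_zero_mat[OF that(3)] by simp
  have qL: "qform (?L M) (v @\<^sub>v w) = qform M (v @\<^sub>v w) - g\<^sup>2 * qform (?V M) (A *\<^sub>v v + B *\<^sub>v w)"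
    if "sym_mat ?n M" "v \<in> carrier_vec nx" "w \<in> carrier_vec nu" for M v w
  proof -
    have "v @\<^sub>v w \<in> carrier_vec ?n" using that by simp
    then show ?thesis using qO[OF that] sym_mat_carrier[OF that(1)] sym_mat_carrier[OF O[OF that(1)]]
      by (simp add: qform_mat_minus[of _ ?n] qform_mat_smult[of _ ?n])
  qed
  have Gc: "?G \<in> carrier_mat (s + 1) ?N" unfolding Gamma_X_def by (intro carrier_matI) simp_all
  have Gxc: "Gamma_x nx nu x k s K \<in> carrier_mat (s + 1) ?N" unfolding Gamma_x_def by (intro carrier_matI) simp_all
  have Tc: "?T \<in> carrier_mat (s + 1) ?N" using Gc Gxc by auto
  have xz: "x (k l) @\<^sub>v u (k l) \<in> carrier_vec ?n" "x (k l + 1) \<in> carrier_vec nx"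
    "x (k l + 1) @\<^sub>v - (K *\<^sub>v x (k l + 1)) \<in> carrier_vec ?n" if "l \<le> s" for l
  proof -
    show "x (k l) @\<^sub>v u (k l) \<in> carrier_vec ?n" using data(1,2)[OF that] by simp
    show x1: "x (k l + 1) \<in> carrier_vec nx" unfolding data(3)[OF that] using data(1,2)[OF that] A B by simp
    show "x (k l + 1) @\<^sub>v - (K *\<^sub>v x (k l + 1)) \<in> carrier_vec ?n" using x1 K by simp
  qed
  have TL: "?T *\<^sub>v vecs M = ?G *\<^sub>v vecs (?L M)" if M: "sym_mat ?n M" for M
  proof (rule eq_vecI)
    fix l assume "l < dim_vec (?G *\<^sub>v vecs (?L M))"
    then have l: "l \<le> s" using Gc by simp
    note Mc = vecs_carrier[OF sym_mat_carrier[OF M]]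
    have row1: "row ?G l = vecv (x (k l) @\<^sub>v u (k l))"
      unfolding Gamma_X_def using l vecv_carrier[OF xz(1)[OF l]]
      by (subst mat_of_rows_row) (simp_all del: upt_Suc)
    have row2: "row (Gamma_x nx nu x k s K) l = vecv (x (k l + 1) @\<^sub>v - (K *\<^sub>v x (k l + 1)))"
      unfolding Gamma_x_def using l vecv_carrier[OF xz(3)[OF l]]
      by (subst mat_of_rows_row) (simp_all del: upt_Suc)
    have "(?T *\<^sub>v vecs M) $ l = row ?G l \<bullet> vecs M - g\<^sup>2 * (row (Gamma_x nx nu x k s K) l \<bullet> vecs M)"
    proof -
      have "?T *\<^sub>v vecs M = ?G *\<^sub>v vecs M - (g\<^sup>2 \<cdot>\<^sub>m Gamma_x nx nu x k s K) *\<^sub>v vecs M"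
        by (rule minus_mult_distrib_mat_vec[OF Gc smult_carrier_mat[OF Gxc] Mc])
      also have "(g\<^sup>2 \<cdot>\<^sub>m Gamma_x nx nu x k s K) *\<^sub>v vecs M = g\<^sup>2 \<cdot>\<^sub>v (Gamma_x nx nu x k s K *\<^sub>v vecs M)"
        by (rule smult_mat_mult_vec[OF Gxc Mc])
      finally show ?thesis using Gc Gxc l by simp
    qed
    also have "\<dots> = qform M (x (k l) @\<^sub>v u (k l)) - g\<^sup>2 * qform M (x (k l + 1) @\<^sub>v - (K *\<^sub>v x (k l + 1)))"
      unfolding row1 row2 vecv_vecs[OF M xz(1)[OF l]] vecv_vecs[OF M xz(3)[OF l]] ..
    also have "\<dots> = qform (?L M) (x (k l) @\<^sub>v u (k l))"
      unfolding qL[OF M data(1,2)[OF l]] data(3)[OF l, symmetric]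
        qform_value_of[OF sym_mat_carrier[OF M] K xz(2)[OF l]] ..
    also have "\<dots> = (?G *\<^sub>v vecs (?L M)) $ l"
      unfolding vecv_vecs[OF L[OF M] xz(1)[OF l], symmetric] row1[symmetric] using Gc l by simp
    finally show "(?T *\<^sub>v vecs M) $ l = (?G *\<^sub>v vecs (?L M)) $ l" .
  qed (use Gc Gxc in simp)
  \<comment> \<open>If L M = 0, evaluating at the feedback input - K v shows that the value form of
    M is invariant under g (A - B K), hence zero; then M, being determined by that value form, is
    zero as well. Inside this block \<open>?N\<close> is rebound to the scaled closed loop.\<close>
  have L_inj: "M = 0\<^sub>m ?n ?n" if M: "sym_mat ?n M" and LM: "?L M = 0\<^sub>m ?n ?n" for M
  proof -
    let ?N = "g \<cdot>\<^sub>m (A - B * K)"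
    have Nc: "?N \<in> carrier_mat nx nx" using closed_loop_carrier[OF K] by simp
    note Vc = sym_mat_carrier[OF V[OF M]]
    have rN: "rho ?N < 1"
      using rho_smult_le[OF closed_loop_carrier[OF K] nx g(1)] g(2) by simp
    have M0: "qform M (v @\<^sub>v w) = g\<^sup>2 * qform (?V M) (A *\<^sub>v v + B *\<^sub>v w)"
      if "v \<in> carrier_vec nx" "w \<in> carrier_vec nu" for v w
    proof -
      have "v @\<^sub>v w \<in> carrier_vec ?n" using that by simp
      then have "qform (?L M) (v @\<^sub>v w) = 0" unfolding LM by (rule qform_zero_mat)
      then show ?thesis using qL[OF M that] by simp
    qed
    have "qform (?V M) (?N *\<^sub>v v) = qform (?V M) v" if v: "v \<in> carrier_vec nx" for v
    proof -
      have Kv: "K *\<^sub>v v \<in> carrier_vec nu" using K v by simp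
      have m: "- (K *\<^sub>v v) = (-1) \<cdot>\<^sub>v (K *\<^sub>v v)" by auto
      have mc: "- (K *\<^sub>v v) \<in> carrier_vec nu" using Kv by simp
      have Nv: "(A - B * K) *\<^sub>v v \<in> carrier_vec nx" using closed_loop_carrier[OF K] v by (rule mult_mat_vec_carrier)
      have "A *\<^sub>v v + B *\<^sub>v - (K *\<^sub>v v) = (A - B * K) *\<^sub>v v"
        unfolding closed_loop_vec[OF K v] m mult_mat_vec[OF B Kv] using A B v Kv by (intro eq_vecI) auto
      then have "qform (?V M) v = g\<^sup>2 * qform (?V M) ((A - B * K) *\<^sub>v v)"
        using qform_value_of[OF sym_mat_carrier[OF M] K v] M0[OF v mc] by simp
      then show ?thesis
        unfolding smult_mat_mult_vec[OF closed_loop_carrier[OF K] v] qform_smult[OF Vc Nv] by simp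
    qed
    then have V0: "qform (?V M) v = 0" if "v \<in> carrier_vec nx" for v
      using lyapunov_unique[OF Nc nx rN Vc _ that] by blast
    show ?thesis
    proof (rule sym_mat_append_eqI[OF M])
      show "sym_mat ?n (0\<^sub>m ?n ?n)" by (simp add: sym_mat_def)
      fix v w :: "real vec" assume vw: "v \<in> carrier_vec nx" "w \<in> carrier_vec nu"
      have "v @\<^sub>v w \<in> carrier_vec ?n" using vw by simp
      then have "qform (0\<^sub>m ?n ?n) (v @\<^sub>v w) = 0" by (rule qform_zero_mat)
      moreover have "A *\<^sub>v v + B *\<^sub>v w \<in> carrier_vec nx" using A B vw by simp
      ultimately show "qform M (v @\<^sub>v w) = qform (0\<^sub>m ?n ?n) (v @\<^sub>v w)" using M0[OF vw] V0 by simp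
    qed
  qed
  have Qb: "sym_mat ?n (Qbar nx nu Q R)"
    unfolding Qbar_def sym_mat_def using sym_Q sym_R
    by (subst transpose_four_block_mat[of _ nx nx _ nu _ nu]) (auto simp: sym_mat_def)
  have qQb: "qform (Qbar nx nu Q R) (v @\<^sub>v w) = qform Q v + qform R w"
    if "v \<in> carrier_vec nx" "w \<in> carrier_vec nu" for v w
    unfolding qform_def Qbar_def using that Q_carrier R_carrier
    by (subst four_block_mat_mult_vec[of _ nx nx _ nu _ nu]) (auto simp: scalar_prod_append[of _ nx _ nu] zero_mat_mult_vec[of _ nx] zero_mat_mult_vec[of _ nu])
  have LH: "?L H = Qbar nx nu Q R"
    by (rule least_squares_operator_equation[of _ "s + 1" ?n ?T ?L, OF Gc Tc
        full_column_rank_injective[OF Gc rank] L TL L_inj Qb H ls])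
  have gA: "g \<cdot>\<^sub>m A \<in> carrier_mat nx nx" and gB: "g \<cdot>\<^sub>m B \<in> carrier_mat nx nu" using A B by auto
  show ?thesis
  proof (rule sym_mat_append_eqI[OF H sym_mat_Q_function[OF gA gB sym_Q sym_R V[OF H]]])
    fix v w :: "real vec" assume vw: "v \<in> carrier_vec nx" "w \<in> carrier_vec nu"
    have c: "A *\<^sub>v v + B *\<^sub>v w \<in> carrier_vec nx" using A B vw by simp
    have "(g \<cdot>\<^sub>m A) *\<^sub>v v + (g \<cdot>\<^sub>m B) *\<^sub>v w = g \<cdot>\<^sub>v (A *\<^sub>v v + B *\<^sub>v w)"
      unfolding smult_mat_mult_vec[OF A vw(1)] smult_mat_mult_vec[OF B vw(2)] using A B vw
      by (intro smult_add_distrib_vec[of _ nx, symmetric]) auto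
    then show "qform H (v @\<^sub>v w) = qform (Q_function_mat (g \<cdot>\<^sub>m A) (g \<cdot>\<^sub>m B) Q R (?V H)) (v @\<^sub>v w)"
      using qform_Q_function[OF gA gB Q_carrier R_carrier sym_mat_carrier[OF V[OF H]] vw]
        qform_smult[OF sym_mat_carrier[OF V[OF H]] c, of g] qL[OF H vw] qQb[OF vw] LH by simp
  qed
qed

text \<open>Stability of K makes P nonnegative, and comparing K' with the input chosen by K gives
  the last inequality. The result stops there because the loops continue differently: with
  \<open>lyapunov_sigma_margin\<close> in the first and \<open>stable_of_lyapunov\<close> in the
  second.\<close>

lemma policy_improvement:
  assumes K: "K \<in> carrier_mat nu nx" and r: "rho (A - B * K) < 1"
    and H: "sym_mat (nx + nu) H" and HP: "H = Q_function_mat A B Q R P" and P: "P = value_of nx K H"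
  defines "K' \<equiv> gain_of nx H"
  shows "sym_mat nx P" "\<forall>v\<in>carrier_vec nx. 0 \<le> qform P v" "K' \<in> carrier_mat nu nx"
    and "v \<in> carrier_vec nx \<Longrightarrow> qform P v = qform Q v + qform R (K *\<^sub>v v) + qform P ((A - B * K) *\<^sub>v v)"
    and "v \<in> carrier_vec nx \<Longrightarrow> qform Q v + qform R (K' *\<^sub>v v) + qform P ((A - B * K') *\<^sub>v v) \<le> qform P v"
proof -
  show symP: "sym_mat nx P" unfolding P using sym_mat_value_of[OF H K] .
  note Pc = sym_mat_carrier[OF symP]
  have eq: "qform P v = qform Q v + qform R (K *\<^sub>v v) + qform P ((A - B * K) *\<^sub>v v)"
    if v: "v \<in> carrier_vec nx" for v
  proof -
    have Kv: "K *\<^sub>v v \<in> carrier_vec nu" using K v by simp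
    have "qform P v = qform H (v @\<^sub>v - (K *\<^sub>v v))"
      unfolding P using qform_value_of[OF sym_mat_carrier[OF H] K v] .
    then show ?thesis
      using qform_Q_function_feedback[OF Pc v Kv] HP closed_loop_vec[OF K v] by simp
  qed
  then show "v \<in> carrier_vec nx \<Longrightarrow> qform P v = qform Q v + qform R (K *\<^sub>v v) + qform P ((A - B * K) *\<^sub>v v)" .
  show psd: "\<forall>v\<in>carrier_vec nx. 0 \<le> qform P v"
    using lyapunov_pos_def[OF symP K r eq] by blast
  have K'P: "K' = gain_of nx (Q_function_mat A B Q R P)" unfolding K'_def using HP by simp
  show K': "K' \<in> carrier_mat nu nx" using greedy_gain(1)[OF symP psd K'P] .
  assume v: "v \<in> carrier_vec nx"
  have Kv: "K *\<^sub>v v \<in> carrier_vec nu" "K' *\<^sub>v v \<in> carrier_vec nu" using K K' v by auto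
  have "0 \<le> qform R (K *\<^sub>v v - K' *\<^sub>v v)" using pos_def_nonneg[OF R] Kv by simp
  then show "qform Q v + qform R (K' *\<^sub>v v) + qform P ((A - B * K') *\<^sub>v v) \<le> qform P v"
    using greedy_gain_optimal[OF symP psd K'P v Kv(1)] eq[OF v] closed_loop_vec[OF K v] by simp
qed

(* With Pstar, Kstar the Riccati solution and its gain, the value error E_i = P i - Pstar satisfies
   0 <= E_(i+1) <= (A - B Kstar)^T E_i (A - B Kstar), where A - B Kstar is stable; the same chain
   of inequalities bounds the gain error by E_i. *)
lemma policy_iteration_converges:
  assumes Pstar: "sym_pos_def nx Pstar" "ARE A B Q R Pstar"
    and K0: "K 0 \<in> carrier_mat nu nx" "rho (A - B * K 0) < 1"
    and H: "\<And>i. sym_mat (nx + nu) (H i)" and P: "\<And>i. P i = value_of nx (K i) (H i)"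
    and K: "\<And>i. K (Suc i) = gain_of nx (H i)"
    and eval: "\<And>i. K i \<in> carrier_mat nu nx \<Longrightarrow> rho (A - B * K i) < 1 \<Longrightarrow> H i = Q_function_mat A B Q R (P i)"
  shows "mat_tendsto H (Q_function_mat A B Q R Pstar)" "mat_tendsto P Pstar"
    "mat_tendsto (\<lambda>i. K (Suc i)) (optimal_gain A B R Pstar)"
proof -
  define Ks where "Ks = gain_of nx (Q_function_mat A B Q R Pstar)"
  let ?As = "A - B * Ks"
  have symPs: "sym_mat nx Pstar" using Pstar(1) by (simp add: sym_pos_def_def)
  have psdPs: "\<forall>v\<in>carrier_vec nx. 0 \<le> qform Pstar v" using pos_def_nonneg[OF Pstar(1)] by blast
  note Psc = sym_mat_carrier[OF symPs]
  note Ksc = greedy_gain(1)[OF symPs psdPs Ks_def]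
  note Asc = closed_loop_carrier[OF Ksc]
  have ric: "qform Pstar v = qform Q v + qform R (Ks *\<^sub>v v) + qform Pstar (?As *\<^sub>v v)"
    if "v \<in> carrier_vec nx" for v using riccati_fixed_point(2)[OF Pstar that] by (simp add: Ks_def)
  \<comment> \<open>In its Lyapunov form the Riccati equation already certifies stability of its own
    closed loop.\<close>
  have rs: "rho ?As < 1" by (rule stable_of_lyapunov[OF symPs psdPs Ksc]) (simp add: ric)
  have st: "K i \<in> carrier_mat nu nx \<and> rho (A - B * K i) < 1" for i
  proof (induction i)
    case (Suc i)
    note I = policy_improvement[OF conjunct1[OF Suc] conjunct2[OF Suc] H[of i]
        eval[OF conjunct1[OF Suc] conjunct2[OF Suc]] P, folded K[of i]]
    show ?case using I(3) stable_of_lyapunov[OF I(1-3,5)] by blast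
  qed (use K0 in simp)
  have Kc: "K i \<in> carrier_mat nu nx" and r: "rho (A - B * K i) < 1"
    and HP: "H i = Q_function_mat A B Q R (P i)" for i
    using st eval by auto
  note I = policy_improvement[OF Kc r H HP P, folded K]
  note symP = I(1) and psd = I(2) and lyap = I(4) and improve = I(5)
  have KP: "K (Suc i) = gain_of nx (Q_function_mat A B Q R (P i))" for i using K HP by metis
  have vec: "K i *\<^sub>v v \<in> carrier_vec nu" "Ks *\<^sub>v v \<in> carrier_vec nu" "(A - B * K i) *\<^sub>v v \<in> carrier_vec nx"
    "?As *\<^sub>v v \<in> carrier_vec nx" if "v \<in> carrier_vec nx" for i v
    using Kc Ksc closed_loop_carrier[OF Kc] Asc that by (auto intro: mult_mat_vec_carrier)
  \<comment> \<open>Compared along the closed loop of \<open>K (Suc i)\<close>, for which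
    \<open>P (Suc i)\<close> satisfies the Lyapunov equation and \<open>P i\<close> the inequality
    from improvement.\<close>
  have mono: "qform (P (Suc i)) v \<le> qform (P i) v" if v: "v \<in> carrier_vec nx" for i v
  proof -
    note c = sym_mat_carrier[OF symP[of i]] sym_mat_carrier[OF symP[of "Suc i"]]
    have D: "P i - P (Suc i) \<in> carrier_mat nx nx" using c by auto
    have "0 \<le> qform (P i - P (Suc i)) v"
    proof (rule lyapunov_comparison[OF closed_loop_carrier[OF Kc] nx r D _ v])
      fix v :: "real vec" assume v: "v \<in> carrier_vec nx"
      show "qform (P i - P (Suc i)) ((A - B * K (Suc i)) *\<^sub>v v) \<le> qform (P i - P (Suc i)) v"
        unfolding qform_mat_minus[OF c v] qform_mat_minus[OF c vec(3)[OF v]]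
        using improve[OF v, of i] lyap[OF v, of "Suc i"] by simp
    qed
    then show ?thesis using qform_mat_minus[OF c v] by simp
  qed
  \<comment> \<open>Compared along the closed loop of \<open>K i\<close>: there \<open>P i\<close>
    satisfies the Lyapunov equation, while optimality of \<open>Ks\<close> for \<open>Pstar\<close>
    gives the reverse inequality for \<open>Pstar\<close>.\<close>
  have lower: "qform Pstar v \<le> qform (P i) v" if v: "v \<in> carrier_vec nx" for i v
  proof -
    note c = sym_mat_carrier[OF symP[of i]] Psc
    have D: "P i - Pstar \<in> carrier_mat nx nx" using c by auto
    have "0 \<le> qform (P i - Pstar) v"
    proof (rule lyapunov_comparison[OF closed_loop_carrier[OF Kc] nx r D _ v])
      fix v :: "real vec" assume v: "v \<in> carrier_vec nx"
      have "K i *\<^sub>v v - Ks *\<^sub>v v \<in> carrier_vec nu" using vec(1,2)[OF v] by simp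
      then have "0 \<le> qform R (K i *\<^sub>v v - Ks *\<^sub>v v)" using pos_def_nonneg[OF R] by blast
      then have "qform Pstar v \<le> qform Q v + qform R (K i *\<^sub>v v) + qform Pstar ((A - B * K i) *\<^sub>v v)"
        using greedy_gain_optimal[OF symPs psdPs Ks_def v vec(1)[OF v], of i] ric[OF v]
          closed_loop_vec[OF Kc v, of i] by simp
      then show "qform (P i - Pstar) ((A - B * K i) *\<^sub>v v) \<le> qform (P i - Pstar) v"
        unfolding qform_mat_minus[OF c v] qform_mat_minus[OF c vec(3)[OF v]]
        using lyap[OF v, of i] by simp
    qed
    then show ?thesis using qform_mat_minus[OF c v] by simp
  qed
  define E where "E i v = qform (P i) v - qform Pstar v" for i v
  \<comment> \<open>In the Lyapunov equation of \<open>P (Suc i)\<close> the successor value is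
    raised to \<open>P i\<close> by \<open>mono\<close>; then \<open>K (Suc i)\<close>, greedy for
    \<open>P i\<close>, is compared with the input of \<open>Ks\<close>, and the Riccati identity is
    subtracted.\<close>
  have contract: "E (Suc i) v + qform R (Ks *\<^sub>v v - K (Suc i) *\<^sub>v v) \<le> E i (?As *\<^sub>v v)"
    if v: "v \<in> carrier_vec nx" for i v
    using lyap[OF v, of "Suc i"] mono[OF vec(3)[OF v], of i "Suc i"] ric[OF v]
      greedy_gain_optimal[OF symP psd KP v vec(2)[OF v], of i] closed_loop_vec[OF Ksc v]
    unfolding E_def by simp
  have E_nonneg: "0 \<le> E i v" if "v \<in> carrier_vec nx" for i v using lower[OF that] by (simp add: E_def)
  have R_nonneg: "0 \<le> qform R (Ks *\<^sub>v v - K i *\<^sub>v v)" if "v \<in> carrier_vec nx" for i v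
    using pos_def_nonneg[OF R] vec[OF that] by simp
  have E_pow: "E i v \<le> E 0 (?As ^\<^sub>m i *\<^sub>v v)" if "v \<in> carrier_vec nx" for i v
    using that
  proof (induction i arbitrary: v)
    case (Suc i)
    have "?As ^\<^sub>m Suc i *\<^sub>v v = ?As ^\<^sub>m i *\<^sub>v (?As *\<^sub>v v)"
      using assoc_mult_mat_vec[OF pow_carrier_mat[OF Asc] Asc Suc.prems, of i] by simp
    then show ?case using Suc.IH[OF vec(4)[OF Suc.prems]] contract[OF Suc.prems, of i]
        R_nonneg[OF Suc.prems, of "Suc i"] by simp
  next
    case 0
    then show ?case using Asc B by simp
  qed
  have E_lim: "(\<lambda>i. E i v) \<longlonglongrightarrow> 0" if v: "v \<in> carrier_vec nx" for v
  proof (rule tendsto_sandwich[OF _ _ tendsto_const])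
    have "(\<lambda>i. E 0 (?As ^\<^sub>m i *\<^sub>v v)) \<longlonglongrightarrow> 0 - 0" unfolding E_def
      by (intro tendsto_diff qform_pow_tendsto_zero[OF Asc nx rs v] Psc sym_mat_carrier[OF symP])
    then show "(\<lambda>i. E 0 (?As ^\<^sub>m i *\<^sub>v v)) \<longlonglongrightarrow> 0" by simp
  qed (use E_nonneg E_pow v in auto)
  have P_lim: "(\<lambda>i. qform (P i) v) \<longlonglongrightarrow> qform Pstar v" if "v \<in> carrier_vec nx" for v
    using tendsto_add[OF E_lim[OF that] tendsto_const[of "qform Pstar v"]] by (simp add: E_def)
  show "mat_tendsto P Pstar" by (rule sym_mat_tendsto[OF symP symPs P_lim])
  show "mat_tendsto H (Q_function_mat A B Q R Pstar)"
  proof (rule sym_mat_tendsto[OF H sym_mat_Q_function[OF A B sym_Q sym_R symPs]])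
    fix z :: "real vec" assume z: "z \<in> carrier_vec (nx + nu)"
    define v w where "v = vec_first z nx" and "w = vec_last z nu"
    have vw: "v \<in> carrier_vec nx" "w \<in> carrier_vec nu" "z = v @\<^sub>v w" using z by (auto simp: v_def w_def)
    have "A *\<^sub>v v + B *\<^sub>v w \<in> carrier_vec nx" using A B vw by simp
    then show "(\<lambda>i. qform (H i) z) \<longlonglongrightarrow> qform (Q_function_mat A B Q R Pstar) z"
      unfolding vw(3) HP qform_Q_function[OF A B Q_carrier R_carrier Psc vw(1,2)]
        qform_Q_function[OF A B Q_carrier R_carrier sym_mat_carrier[OF symP] vw(1,2)]
      by (intro tendsto_intros P_lim)
  qed
  show "mat_tendsto (\<lambda>i. K (Suc i)) (optimal_gain A B R Pstar)"
    unfolding riccati_fixed_point(1)[OF Pstar] Ks_def[symmetric] mat_tendsto_def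
  proof (intro conjI allI impI)
    fix i show "K (Suc i) \<in> carrier_mat (dim_row Ks) (dim_col Ks)" using Kc Ksc by auto
  next
    fix a b assume "a < dim_row Ks" "b < dim_col Ks"
    then have ab: "a < nu" "b < nx" using Ksc by auto
    obtain c where c: "c > 0" "\<And>v. v \<in> carrier_vec nu \<Longrightarrow> c * (v \<bullet> v) \<le> qform R v"
      using pos_def_coercive[OF R] by blast
    let ?e = "unit_vec nx b :: real vec"
    have e: "?e \<in> carrier_vec nx" by simp
    have entry: "(M *\<^sub>v ?e) $ a = M $$ (a, b)" if "M \<in> carrier_mat nu nx" for M
      using that ab by (simp add: scalar_prod_right_unit)
    \<comment> \<open>The unit vector selects column b of the gain error. Coercivity of R converts
      the remainder in \<open>contract\<close> into a bound on the squared entry, after dropping the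
      nonnegative \<open>E (Suc i)\<close>.\<close>
    have bound: "norm ((Ks $$ (a, b) - K (Suc i) $$ (a, b))\<^sup>2) \<le> norm (E i (?As *\<^sub>v ?e)) * (1 / c)" for i
    proof -
      define d where "d = Ks *\<^sub>v ?e - K (Suc i) *\<^sub>v ?e"
      have d: "d \<in> carrier_vec nu" using vec[OF e] by (simp add: d_def)
      have "d $ a = Ks $$ (a, b) - K (Suc i) $$ (a, b)"
      proof -
        have "a < dim_vec (K (Suc i) *\<^sub>v ?e)"
          using carrier_vecD[OF vec(1)[OF e, of "Suc i"]] ab by (simp only:)
        then show ?thesis unfolding d_def by (simp only: index_minus_vec(1) entry[OF Ksc] entry[OF Kc])
      qed
      moreover have "(d $ a)\<^sup>2 \<le> d \<bullet> d" using vec_index_le_norm[of a d] d ab by simp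
      moreover have "c * (d \<bullet> d) \<le> E i (?As *\<^sub>v ?e)"
        using c(2)[OF d] contract[OF e, of i] E_nonneg[OF e, of "Suc i"] by (simp add: d_def)
      then have "d \<bullet> d \<le> E i (?As *\<^sub>v ?e) / c" using c(1) by (simp add: field_simps)
      moreover have "E i (?As *\<^sub>v ?e) \<le> norm (E i (?As *\<^sub>v ?e))" by simp
      ultimately show ?thesis using c(1) E_nonneg[OF vec(4)[OF e], of i] by simp
    qed
    have "(\<lambda>i. (Ks $$ (a, b) - K (Suc i) $$ (a, b))\<^sup>2) \<longlonglongrightarrow> 0"
      by (rule tendsto_0_le[OF E_lim[OF vec(4)[OF e]], of _ "1 / c"]) (use bound in simp)
    then have "(\<lambda>i. Ks $$ (a, b) - K (Suc i) $$ (a, b)) \<longlonglongrightarrow> 0" by simp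
    from tendsto_diff[OF tendsto_const[of "Ks $$ (a, b)"] this]
    show "(\<lambda>i. K (Suc i) $$ (a, b)) \<longlonglongrightarrow> Ks $$ (a, b)" by simp
  qed
qed

section \<open>One step of the scaled iteration\<close>

lemma lqr_scale: "lqr nx nu (g \<cdot>\<^sub>m A) (g \<cdot>\<^sub>m B) Q R"
  using nx A B Q R by unfold_locales auto

lemma closed_loop_scale:
  assumes "K \<in> carrier_mat nu nx"
  shows "g \<cdot>\<^sub>m A - g \<cdot>\<^sub>m B * K = g \<cdot>\<^sub>m (A - B * K)"
  using A B assms by (intro eq_matI) (auto simp: scalar_prod_def sum_distrib_left algebra_simps)

text \<open>Policy improvement for (g A, g B) is a Lyapunov inequality for A - B K' carrying the
  factor g^2; the slack W = Q + K'^T R K' then pays for raising g to g + a. Thus the invariant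
  passes from (g, K) to (g + a, K').\<close>

lemma scaled_policy_step:
  assumes K: "K \<in> carrier_mat nu nx" and g: "0 < g" "g * rho (A - B * K) < 1"
    and H: "sym_mat (nx + nu) H"
    and HP: "H = Q_function_mat (g \<cdot>\<^sub>m A) (g \<cdot>\<^sub>m B) Q R P" and P: "P = value_of nx K H"
    and K': "K' = gain_of nx H"
    and \<alpha>: "0 < a" "a < g * sqrt (sigma_min (Q + K'\<^sup>T * R * K') / sigma_max (P - Q - K'\<^sup>T * R * K') + 1) - g"
  shows "K' \<in> carrier_mat nu nx" "(g + a) * rho (A - B * K') < 1"
proof -
  interpret scaled: lqr nx nu "g \<cdot>\<^sub>m A" "g \<cdot>\<^sub>m B" Q R by (rule lqr_scale)
  have r: "rho (g \<cdot>\<^sub>m A - g \<cdot>\<^sub>m B * K) < 1"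
    unfolding closed_loop_scale[OF K] using rho_smult_le[OF closed_loop_carrier[OF K] nx g(1)] g(2) by simp
  note I = scaled.policy_improvement[OF K r H HP P, folded K']
  show K'c: "K' \<in> carrier_mat nu nx" by (rule I(3))
  note Pc = sym_mat_carrier[OF I(1)]
  let ?W = "Q + K'\<^sup>T * R * K'"
  have c: "K'\<^sup>T * R * K' \<in> carrier_mat nx nx" using K'c R_carrier by auto
  have qW: "qform ?W v = qform Q v + qform R (K' *\<^sub>v v)" if "v \<in> carrier_vec nx" for v
    using qform_mat_add[OF Q_carrier c that] qform_congruence[OF K'c R_carrier that] by simp
  have W: "sym_pos_def nx ?W" unfolding sym_pos_def_def
  proof (intro conjI ballI impI)
    show "sym_mat nx ?W" by (intro sym_mat_add sym_mat_congruence[OF K'c] sym_Q sym_R)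
    fix v :: "real vec" assume v: "v \<in> carrier_vec nx" "v \<noteq> 0\<^sub>v nx"
    have "0 < qform Q v" using pos_def_pos[OF Q] v by blast
    moreover have "0 \<le> qform R (K' *\<^sub>v v)" using pos_def_nonneg[OF R] K'c v by simp
    ultimately show "0 < v \<bullet> (?W *\<^sub>v v)" using qW[OF v(1)] by (simp add: qform_def)
  qed
  have S: "P - Q - K'\<^sup>T * R * K' = P - ?W"
    using Pc Q_carrier c by (intro eq_matI) auto
  show "(g + a) * rho (A - B * K') < 1"
  proof (rule lyapunov_sigma_margin[OF closed_loop_carrier[OF K'c] nx I(1) W I(2) g(1) _ _ S])
    show "g < g + a" using \<alpha> by simp
    show "g + a < g * sqrt (sigma_min ?W / sigma_max (P - Q - K'\<^sup>T * R * K') + 1)" using \<alpha>(2) by simp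
    fix v :: "real vec" assume v: "v \<in> carrier_vec nx"
    have "qform P ((g \<cdot>\<^sub>m (A - B * K')) *\<^sub>v v) = g\<^sup>2 * qform P ((A - B * K') *\<^sub>v v)"
      unfolding smult_mat_mult_vec[OF closed_loop_carrier[OF K'c] v]
      by (rule qform_smult[OF Pc mult_mat_vec_carrier[OF closed_loop_carrier[OF K'c] v]])
    then show "g\<^sup>2 * qform P ((A - B * K') *\<^sub>v v) + qform ?W v \<le> qform P v"
      using I(5)[OF v] qW[OF v] closed_loop_scale[OF K'c, of g] by simp
  qed
qed

end

section \<open>The two loops on the data\<close>

lemma executed_Suc: "executed \<gamma> (Suc j) \<Longrightarrow> executed \<gamma> j"
  by (simp add: executed_def)

theorem theorem4:
  fixes nx nu s :: nat
    and A B Q R Pstar :: "real mat"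
    and \<beta> :: real
    and \<alpha> \<gamma> :: "nat \<Rightarrow> real"
    and x u :: "nat \<Rightarrow> real vec"
    and k :: "nat \<Rightarrow> nat"
    and \<xi> :: "real vec"
    and Ht Kt Pt :: "nat \<Rightarrow> real mat"
  assumes dims: "0 < nx" "0 < nu"
    and A: "A \<in> carrier_mat nx nx"
    and B: "B \<in> carrier_mat nx nu"
    and stab: "stabilizable nx nu A B"
    and rhoA: "0 < rho A"
    and Q: "sym_pos_def nx Q"
    and R: "sym_pos_def nu R"
    and Pstar: "sym_pos_def nx Pstar" "ARE A B Q R Pstar"
    and init: "0 < \<beta>" "0 < \<alpha> 0" "\<beta> + \<alpha> 0 < 1 / rho A"
    and \<gamma>: "\<And>j. \<gamma> j = \<beta> + (\<Sum>m\<le>j. \<alpha> m)"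
    and times: "\<And>l. l < s \<Longrightarrow> k l < k (l + 1)"
    and x_dim: "\<And>l. l \<le> s \<Longrightarrow> x (k l) \<in> carrier_vec nx"
    and u_dim: "\<And>l. l \<le> s \<Longrightarrow> u (k l) \<in> carrier_vec nu"
    and dynamics: "\<And>l. l \<le> s \<Longrightarrow> x (k l + 1) = A *\<^sub>v x (k l) + B *\<^sub>v u (k l)"
    and rank: "vec_space.rank (s + 1) (Gamma_X nx nu x u k s) = (nx + nu) * (nx + nu + 1) div 2"
    and \<xi>: "\<xi> = Gamma_X nx nu x u k s *\<^sub>v vecs (Qbar nx nu Q R)"
    and Kt_0: "Kt 0 = 0\<^sub>m nu nx"
    and Ht: "\<And>j. executed \<gamma> j \<Longrightarrow> sym_mat (nx + nu) (Ht j) \<and>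
          vecs (Ht j) =
            least_squares (Gamma_X nx nu x u k s - (\<gamma> j)\<^sup>2 \<cdot>\<^sub>m Gamma_x nx nu x k s (Kt j)) \<xi>"
    and Kt: "\<And>j. executed \<gamma> j \<Longrightarrow> Kt (j + 1) = gain_of nx (Ht j)"
    and Pt: "\<And>j. executed \<gamma> j \<Longrightarrow> Pt j = value_of nx (Kt j) (Ht j)"
    and \<alpha>: "\<And>j. executed \<gamma> j \<Longrightarrow> 0 < \<alpha> (j + 1) \<and>
          \<alpha> (j + 1) <
            \<gamma> j * sqrt (sigma_min (Q + (Kt (j + 1))\<^sup>T * R * Kt (j + 1)) /
                       sigma_max (Pt j - Q - (Kt (j + 1))\<^sup>T * R * Kt (j + 1)) + 1) - \<gamma> j"
  shows "(\<forall>j. executed \<gamma> j \<longrightarrow> rho (A - B * Kt (j + 1)) < 1 / (\<beta> + (\<Sum>m\<le>j + 1. \<alpha> m))) \<and>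
    (\<forall>J. executed \<gamma> J \<and> 1 \<le> \<gamma> (J + 1) \<longrightarrow>
       rho (A - B * Kt (J + 1)) < 1 \<and>
       (\<forall>H K P.
          K 0 = Kt (J + 1) \<and>
          (\<forall>i. sym_mat (nx + nu) (H i) \<and>
               vecs (H i) =
                 least_squares (Gamma_X nx nu x u k s - Gamma_x nx nu x k s (K i)) \<xi> \<and>
               K (i + 1) = gain_of nx (H i) \<and>
               P i = value_of nx (K i) (H i)) \<longrightarrow>
          mat_tendsto H (Q_function_mat A B Q R Pstar) \<and>
          mat_tendsto P Pstar \<and>
          mat_tendsto (\<lambda>i. K (i + 1)) (optimal_gain A B R Pstar)))"
proof -
  interpret lqr nx nu A B Q R using dims A B Q R by unfold_locales
  let ?G = "Gamma_X nx nu x u k s"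
  have \<gamma>_Suc: "\<gamma> (Suc j) = \<gamma> j + \<alpha> (Suc j)" for j unfolding \<gamma> by simp
  have \<gamma>_pos: "executed \<gamma> j \<Longrightarrow> 0 < \<gamma> j" for j
  proof (induction j)
    case 0
    then show ?case using init by (simp add: \<gamma>)
  next
    case (Suc j)
    then show ?case using \<alpha>[OF executed_Suc[OF Suc.prems]] executed_Suc[OF Suc.prems] by (simp add: \<gamma>_Suc)
  qed
  have step: "Kt (Suc j) \<in> carrier_mat nu nx \<and> \<gamma> (Suc j) * rho (A - B * Kt (Suc j)) < 1"
    if ex: "executed \<gamma> j" and K: "Kt j \<in> carrier_mat nu nx" "\<gamma> j * rho (A - B * Kt j) < 1" for j
  proof -
    have H: "sym_mat (nx + nu) (Ht j)" using Ht[OF ex] by blast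
    have HP: "Ht j = Q_function_mat (\<gamma> j \<cdot>\<^sub>m A) (\<gamma> j \<cdot>\<^sub>m B) Q R (Pt j)"
      unfolding Pt[OF ex]
      by (rule policy_evaluation[OF x_dim u_dim dynamics rank K(1) \<gamma>_pos[OF ex] K(2) H])
        (use Ht[OF ex] in \<open>simp_all add: \<xi>\<close>)
    show ?thesis
      using scaled_policy_step[OF K(1) \<gamma>_pos[OF ex] K(2) H HP Pt[OF ex] Kt[OF ex]
          conjunct1[OF \<alpha>[OF ex]] conjunct2[OF \<alpha>[OF ex]]]
      by (simp add: \<gamma>_Suc)
  qed
  \<comment> \<open>At j = 0 the closed loop is A itself, and the bound on the initial factor is the
    hypothesis on \<open>\<beta> + \<alpha> 0\<close>.\<close>
  have inv: "executed \<gamma> j \<Longrightarrow> Kt j \<in> carrier_mat nu nx \<and> \<gamma> j * rho (A - B * Kt j) < 1" for j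
  proof (induction j)
    case 0
    have "A - B * 0\<^sub>m nu nx = A" using A B by (intro eq_matI) auto
    moreover have "\<gamma> 0 * rho A < 1" using init rhoA by (simp add: \<gamma> field_simps)
    ultimately show ?case by (simp add: Kt_0)
  next
    case (Suc j)
    then show ?case using step executed_Suc by blast
  qed
  \<comment> \<open>Stated at \<open>Suc j\<close> under execution of j only. This covers the last
    iteration, whose new factor is at least 1, so that \<open>Suc j\<close> is no longer
    executed.\<close>
  have stable: "Kt (Suc j) \<in> carrier_mat nu nx" "\<gamma> (Suc j) * rho (A - B * Kt (Suc j)) < 1" "0 < \<gamma> (Suc j)"
    if "executed \<gamma> j" for j
    using step inv \<alpha>[OF that] \<gamma>_pos[OF that] that by (auto simp: \<gamma>_Suc)
  have second: "mat_tendsto H (Q_function_mat A B Q R Pstar) \<and> mat_tendsto P Pstar \<and>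
      mat_tendsto (\<lambda>i. K (i + 1)) (optimal_gain A B R Pstar)"
    if K0: "K 0 \<in> carrier_mat nu nx" "rho (A - B * K 0) < 1"
      and it: "\<forall>i. sym_mat (nx + nu) (H i) \<and>
               vecs (H i) = least_squares (?G - Gamma_x nx nu x k s (K i)) \<xi> \<and>
               K (i + 1) = gain_of nx (H i) \<and> P i = value_of nx (K i) (H i)" for H K P
  proof -
    \<comment> \<open>The second loop is policy evaluation with factor 1, up to removing the trivial
      scalings.\<close>
    have one: "1 \<cdot>\<^sub>m M = M" for M :: "real mat" by (intro eq_matI) auto
    have "H i = Q_function_mat A B Q R (P i)" if "K i \<in> carrier_mat nu nx" "rho (A - B * K i) < 1" for i
    proof -
      have "H i = Q_function_mat (1 \<cdot>\<^sub>m A) (1 \<cdot>\<^sub>m B) Q R (value_of nx (K i) (H i))"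
        by (rule policy_evaluation[OF x_dim u_dim dynamics rank that(1)])
          (use it that(2) in \<open>simp_all add: \<xi> one\<close>)
      then show ?thesis using it by (simp add: one)
    qed
    then show ?thesis
      using policy_iteration_converges[OF Pstar, of K H P] K0 it by simp
  qed
  show ?thesis
  proof (intro conjI allI impI)
    fix j assume "executed \<gamma> j"
    from stable[OF this] show "rho (A - B * Kt (j + 1)) < 1 / (\<beta> + (\<Sum>m\<le>j + 1. \<alpha> m))"
      unfolding \<gamma>[symmetric] by (simp add: field_simps)
  next
    fix J assume J: "executed \<gamma> J \<and> 1 \<le> \<gamma> (J + 1)"
    note S = stable[OF conjunct1[OF J]]
    \<comment> \<open>Replacing the factor by 1 does not increase the product since the spectral
      radius is nonnegative; this is where stopping at a factor of at least 1 gives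
      stability.\<close>
    have "1 * rho (A - B * Kt (Suc J)) \<le> \<gamma> (Suc J) * rho (A - B * Kt (Suc J))"
      using J rho_nonneg[OF closed_loop_carrier[OF S(1)] nx] by (intro mult_right_mono) auto
    then have r: "rho (A - B * Kt (Suc J)) < 1" using S(2) by simp
    then show "rho (A - B * Kt (J + 1)) < 1" by simp
    fix H K P :: "nat \<Rightarrow> real mat"
    assume *: "K 0 = Kt (J + 1) \<and>
      (\<forall>i. sym_mat (nx + nu) (H i) \<and>
               vecs (H i) = least_squares (?G - Gamma_x nx nu x k s (K i)) \<xi> \<and>
               K (i + 1) = gain_of nx (H i) \<and> P i = value_of nx (K i) (H i))"
    have "K 0 \<in> carrier_mat nu nx" "rho (A - B * K 0) < 1" using * S(1) r by auto
    from second[OF this conjunct2[OF *]]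
    show "mat_tendsto H (Q_function_mat A B Q R Pstar)" "mat_tendsto P Pstar"
      "mat_tendsto (\<lambda>i. K (i + 1)) (optimal_gain A B R Pstar)" by auto
  qed
qed

end
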